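(* For any fixed integer $d \ge 4$, asymptotically almost surely $$H(\mathcal{G}_{n,d}) \le (1+o(1))\,\frac{(d-1)!\,(d-2)^{d-1}}{\prod_{i=1}^{d-1}\big(i(d-2)+1\big)}\, n.$$
   Context: Hopping forcing: given a graph $G$ with each vertex coloured blue or white, the hopping forcing rule allows a blue vertex $b$ to force (recolour blue) a white vertex $w$ at distance exactly two from $b$, provided that every neighbour of $b$ is blue and $b$ has not previously performed a force (each vertex can perform at most one force). A set $B\subseteq V(G)$ is feasible if, starting with exactly the vertices of $B$ blue, repeated sequential applications of the rule can make all vertices blue. The hopping forcing number $H(G)$ is the minimum size of a feasible set. $\mathcal{G}_{n,d}$ is a uniformly random $d$-regular simple graph on $n$ labelled vertices ($dn$ even), $d$ fixed, $n\to\infty$. An event holds asymptotically almost surely (a.a.s.) if its probability tends to $1$ as $n\to\infty$. *)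

theory Defs
  imports "HOL-Probability.Probability" "Graph_Theory.Pair_Digraph" "Graph_Theory.Shortest_Path"
begin

text \<open>
  A finite simple graph is a \<^locale>\<open>pair_graph\<close>: finite, loopless and symmetric, so that an
  edge \<open>uv\<close> is the pair of arcs \<open>(u, v)\<close> and \<open>(v, u)\<close>, and \<^const>\<open>out_degree\<close> is the degree.
\<close>

definition neighbours :: "'a pair_pre_digraph \<Rightarrow> 'a \<Rightarrow> 'a set" where
  "neighbours G v = {u. (v, u) \<in> parcs G}"

text \<open>Graph distance: least cost of a walk, every arc having cost 1 (infinite if there is none).\<close>

definition graph_dist :: "'a pair_pre_digraph \<Rightarrow> 'a \<Rightarrow> 'a \<Rightarrow> ereal" where
  "graph_dist G u v = wf_digraph.\<mu> (with_proj G) (\<lambda>_. 1) u v"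

text \<open>
  A state is a pair \<open>(B, F)\<close>: the currently blue vertices \<open>B\<close> and the vertices \<open>F\<close> that
  have already performed a force.
\<close>

inductive hop_step ::
    "'a pair_pre_digraph \<Rightarrow> 'a set \<times> 'a set \<Rightarrow> 'a set \<times> 'a set \<Rightarrow> bool" for G where
  force: "\<lbrakk> b \<in> B; b \<notin> F; neighbours G b \<subseteq> B; w \<in> pverts G; w \<notin> B; graph_dist G b w = 2 \<rbrakk>
    \<Longrightarrow> hop_step G (B, F) (insert w B, insert b F)"

definition hop_feasible :: "'a pair_pre_digraph \<Rightarrow> 'a set \<Rightarrow> bool" where
  "hop_feasible G B \<longleftrightarrow> B \<subseteq> pverts G \<and> (\<exists>F. (hop_step G)\<^sup>*\<^sup>* (B, {}) (pverts G, F))"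

definition hopping_number :: "'a pair_pre_digraph \<Rightarrow> nat" where
  "hopping_number G = (LEAST k. \<exists>B. hop_feasible G B \<and> card B = k)"

definition regular_graphs :: "nat \<Rightarrow> nat \<Rightarrow> nat pair_pre_digraph set" where
  "regular_graphs n d =
    {G. pair_graph G \<and> pverts G = {..<n} \<and> (\<forall>v\<in>pverts G. out_degree (with_proj G) v = d)}"

text \<open>
  Only meaningful when \<open>regular_graphs n d\<close> is nonempty, i.e. when \<open>d * n\<close> is even and \<open>n > d\<close>
  (or \<open>n = 0\<close>); \<^const>\<open>pmf_of_set\<close> is unspecified on the empty set.
\<close>

definition random_regular_graph :: "nat \<Rightarrow> nat \<Rightarrow> nat pair_pre_digraph pmf" where
  "random_regular_graph n d = pmf_of_set (regular_graphs n d)"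

text \<open>An event holds a.a.s. if its probability tends to 1 as \<open>n\<close> goes to infinity with \<open>d * n\<close> even.\<close>

definition aas_regular :: "nat \<Rightarrow> (nat \<Rightarrow> nat pair_pre_digraph \<Rightarrow> bool) \<Rightarrow> bool" where
  "aas_regular d P \<longleftrightarrow>
    ((\<lambda>n. measure_pmf.prob (random_regular_graph n d) {G. P n G}) \<longlongrightarrow> 1)
      (inf sequentially (principal {n. even (d * n)}))"

lemma finite_regular_graphs: "finite (regular_graphs n d)"
proof -
  have "regular_graphs n d \<subseteq>
      (\<lambda>A. \<lparr>pverts = {..<n}, parcs = A\<rparr>) ` Pow ({..<n} \<times> {..<n})"
  proof
    fix G assume G: "G \<in> regular_graphs n d"
    then interpret pair_graph G by (simp add: regular_graphs_def)
    have "parcs G \<subseteq> {..<n} \<times> {..<n}"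
      using G in_arcsD1 in_arcsD2 by (auto simp: regular_graphs_def)
    with G show "G \<in> (\<lambda>A. \<lparr>pverts = {..<n}, parcs = A\<rparr>) ` Pow ({..<n} \<times> {..<n})"
      by (intro image_eqI[of _ _ "parcs G"]) (auto simp: regular_graphs_def)
  qed
  then show ?thesis by (rule finite_subset) simp
qed

lemma hop_feasible_pverts: "hop_feasible G (pverts G)"
  by (auto simp: hop_feasible_def)

lemma graph_dist_eq_2_iff:
  assumes "pair_graph G" "b \<in> pverts G"
  shows "graph_dist G b w = 2 \<longleftrightarrow>
    w \<noteq> b \<and> w \<notin> neighbours G b \<and> (\<exists>u \<in> neighbours G b. w \<in> neighbours G u)"
proof -
  interpret pair_graph G by fact
  have cost: "awalk_cost (\<lambda>_. 1) p = real (length p)" for p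
    by (induction p) auto
  have gd: "graph_dist G b w = (INF p\<in>{p. awalk b p w}. ereal (real (length p)))"
    by (simp add: graph_dist_def \<mu>_def cost)
  have w0: "awalk b [] w \<longleftrightarrow> w = b"
    using assms(2) by (auto simp: awalk_def)
  have w1: "awalk b [e] w \<longleftrightarrow> e = (b, w) \<and> (b, w) \<in> parcs G" for e
    using assms(2) by (auto simp: awalk_def)
  have w2: "awalk b [e, f] w \<longleftrightarrow>
      (\<exists>u. e = (b, u) \<and> f = (u, w) \<and> (b, u) \<in> parcs G \<and> (u, w) \<in> parcs G)" for e f
    using assms(2) by (cases e; cases f) (auto simp: awalk_def)
  show ?thesis
  proof
    assume L: "graph_dist G b w = 2"
    have ge: "length p \<ge> 2" if "awalk b p w" for p
    proof -
      have "graph_dist G b w \<le> ereal (real (length p))"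
        unfolding gd using that by (intro INF_lower) auto
      with L have "ereal 2 \<le> ereal (real (length p))" by simp
      then show ?thesis by simp
    qed
    have "\<exists>p. awalk b p w \<and> length p < 3"
    proof (rule ccontr)
      assume "\<not> ?thesis"
      then have "ereal 3 \<le> graph_dist G b w"
        unfolding gd by (intro INF_greatest) (auto simp: not_less)
      with L show False by simp
    qed
    then obtain p where p: "awalk b p w" "length p < 3" by blast
    with ge[of p] have "length p = 2" by simp
    then obtain e f where "p = [e, f]" by (auto simp: length_Suc_conv numeral_2_eq_2)
    with p w2 obtain u where "(b, u) \<in> parcs G" "(u, w) \<in> parcs G" by blast
    moreover have "w \<noteq> b" using w0 ge[of "[]"] by auto
    moreover have "(b, w) \<notin> parcs G" using w1 ge[of "[(b, w)]"] by auto
    ultimately show "w \<noteq> b \<and> w \<notin> neighbours G b \<and> (\<exists>u \<in> neighbours G b. w \<in> neighbours G u)"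
      by (auto simp: neighbours_def)
  next
    assume R: "w \<noteq> b \<and> w \<notin> neighbours G b \<and> (\<exists>u \<in> neighbours G b. w \<in> neighbours G u)"
    then obtain u where u: "(b, u) \<in> parcs G" "(u, w) \<in> parcs G" by (auto simp: neighbours_def)
    have "graph_dist G b w \<le> ereal (real (length [(b, u), (u, w)]))"
      unfolding gd using u w2 by (intro INF_lower) auto
    moreover have "ereal 2 \<le> graph_dist G b w"
      unfolding gd
    proof (rule INF_greatest)
      fix p assume "p \<in> {p. awalk b p w}"
      then have p: "awalk b p w" by simp
      have "length p \<noteq> 0" using p w0 R by auto
      moreover have "length p \<noteq> 1"
        using p w1 R by (auto simp: neighbours_def length_Suc_conv)
      ultimately have "length p \<ge> 2" by linarith
      then show "ereal 2 \<le> ereal (real (length p))" by simp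
    qed
    ultimately show "graph_dist G b w = 2" by simp
  qed
qed

end

theory Submission
  imports Defs
begin

text \<open>
  The constant is \<open>\<integral>\<^sub>0\<^sup>1 (1 - s^(d-2))^(d-1) ds\<close>. Cover a \<open>d\<close>-regular graph with few short cycles by
  few long paths, cut these into pieces of bounded length and process the vertices piece by piece,
  with independent uniform labels deciding the order of the pieces. When \<open>u\<close> is processed, its
  predecessor \<open>b\<close> on the piece can force any neighbour \<open>w\<close> of \<open>u\<close> such that \<open>u\<close> is the first
  processed vertex of the closed neighbourhood of \<open>w\<close>, and no other vertex ever claims this \<open>w\<close>.
  If the remaining fraction of labels is \<open>s\<close>, each of the \<open>d - 1\<close> neighbours other than \<open>b\<close>
  qualifies with probability \<open>s^(d-2)\<close>, because its closed neighbourhood meets \<open>d - 2\<close> further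
  pieces; hence \<open>u\<close> yields no force with probability \<open>(1 - s^(d-2))^(d-1)\<close>.

  The path cover comes from two successive nearly perfect matchings. The bipartite double cover of a
  nearly regular graph has a nearly perfect matching by Hall's theorem, that is, a partial injection
  along edges; its orbits are paths and cycles, and only cycles of odd length at least 3 lose
  a vertex, of which there are few when short cycles are rare. Finally, a switching argument bounds
  the expected number of short cycles in a random regular graph.
\<close>

section \<open>Marriage theorem, paths and cycles\<close>

text \<open>Processing whole pieces instead of single vertices serves twice. The predecessor
  \<open>b\<close> of \<open>u\<close> is always ranked before \<open>u\<close> and is a private
  forcer for it; and \<open>w\<close> shares one label with its two neighbours on its own piece.
  Independent labels on all d + 1 vertices of a closed neighbourhood would give the exponent d;
  sharing lowers it to d - 2, which is the source of the constant. Pieces must be long, because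
  their ends are lost, yet of bounded length: independence fails where \<open>u\<close> and a
  segment of a piece lie on a cycle, and only cycles of bounded length are rare. Labels come from
  the finite set \<open>{..<N}\<close>, so the integral enters through Riemann sums, and ties count
  as failures. Some labelling is at least as good as the average, hence every d-regular graph
  satisfies a deterministic bound c n + O(z) + O(n/m), where z counts the vertices on cycles of
  length at most m + 3. The random graph matters only through the mean of z. Hall's theorem on the
  double cover keeps the matching step elementary: its condition follows by counting arcs, at the
  price of the odd cycles.\<close>

text \<open>The induction of Halmos and Vaughan. A proper non-empty tight set S is matched on its
  own, and the rest still satisfies the condition after the neighbours of S are deleted. If no set
  is tight, every proper non-empty set has one neighbour to spare, so any \<open>a\<close> may take
  any \<open>b\<close> in \<open>N a\<close>.\<close>

lemma hall_marriage:
  assumes "finite A" "\<And>a. a \<in> A \<Longrightarrow> finite (N a)"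
    and "\<And>S. S \<subseteq> A \<Longrightarrow> card S \<le> card (\<Union> (N ` S))"
  shows "\<exists>f. inj_on f A \<and> (\<forall>a\<in>A. f a \<in> N a)"
  using assms
proof (induction "card A" arbitrary: A N rule: less_induct)
  case less
  note IH = less.hyps and finA = less.prems(1) and finN = less.prems(2) and hall = less.prems(3)
  have finU: "finite (\<Union> (N ` S))" if "S \<subseteq> A" for S
    using that finA finN by (meson finite_UN_I finite_subset subsetD)
  show ?case
  proof (cases "\<exists>S. S \<subset> A \<and> S \<noteq> {} \<and> card (\<Union> (N ` S)) = card S")
    case True
    then obtain S where S: "S \<subset> A" "S \<noteq> {}" "card (\<Union> (N ` S)) = card S" by blast
    have finS: "finite S" using S finA by (meson finite_subset psubset_imp_subset)
    have "card S < card A" using S finA by (simp add: psubset_card_mono)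
    then have "\<exists>f. inj_on f S \<and> (\<forall>a\<in>S. f a \<in> N a)"
      by (rule IH) (use finN hall S finS in auto)
    then obtain f where f: "inj_on f S" "\<forall>a\<in>S. f a \<in> N a" by blast
    define T where "T = \<Union> (N ` S)"
    have finT: "finite T" unfolding T_def using finU S by blast
    have lt: "card (A - S) < card A" using S finA by (intro psubset_card_mono) auto
    have hall':  "card R \<le> card (\<Union> ((\<lambda>a. N a - T) ` R))" if "R \<subseteq> A - S" for R
    proof -
      have finR: "finite R" using that finA by (meson Diff_subset finite_subset)
      have "card R + card S = card (R \<union> S)" using that finR finS
        by (subst card_Un_disjoint) auto
      also have "\<dots> \<le> card (\<Union> (N ` (R \<union> S)))" using that S by (intro hall) auto
      also have "\<Union> (N ` (R \<union> S)) = \<Union> ((\<lambda>a. N a - T) ` R) \<union> T" by (auto simp: T_def)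
      also have "card \<dots> \<le> card (\<Union> ((\<lambda>a. N a - T) ` R)) + card T" by (rule card_Un_le)
      finally show ?thesis using S by (simp add: T_def)
    qed
    have "\<exists>g. inj_on g (A - S) \<and> (\<forall>a\<in>A - S. g a \<in> N a - T)"
      using lt by (rule IH) (use finA finN hall' in auto)
    then obtain g where g: "inj_on g (A - S)" "\<forall>a\<in>A - S. g a \<in> N a - T" by blast
    define h where "h = (\<lambda>a. if a \<in> S then f a else g a)"
    have "f a \<in> T" if "a \<in> S" for a using f that by (auto simp: T_def)
    moreover have "g a \<notin> T" if "a \<in> A - S" for a using g that by auto
    ultimately have "h a \<in> T \<longleftrightarrow> a \<in> S" if "a \<in> A" for a
      using that by (auto simp: h_def)
    then have "inj_on h A"
      using f(1) g(1) by (intro inj_onI) (metis Diff_iff h_def inj_onD)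
    moreover have "\<forall>a\<in>A. h a \<in> N a" using f g by (auto simp: h_def)
    ultimately show ?thesis by blast
  next
    case nS: False
    show ?thesis
    proof (cases "A = {}")
      case True then show ?thesis by auto
    next
      case ne: False
      then obtain a where a: "a \<in> A" by blast
      have "card {a} \<le> card (\<Union> (N ` {a}))" using a by (intro hall) auto
      then have "N a \<noteq> {}" by auto
      then obtain b where b: "b \<in> N a" by blast
      have hall': "card R \<le> card (\<Union> ((\<lambda>x. N x - {b}) ` R))" if "R \<subseteq> A - {a}" for R
      proof (cases "R = {}")
        case False
        have "card R \<le> card (\<Union> (N ` R))" using that by (intro hall) auto
        moreover have "card R \<noteq> card (\<Union> (N ` R))"
        proof -
          have "R \<subset> A" using that a by blast
          then show ?thesis using nS False by metis
        qed
        moreover have "\<Union> ((\<lambda>x. N x - {b}) ` R) = \<Union> (N ` R) - {b}" by auto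
        ultimately show ?thesis by (auto simp: card_Diff_singleton_if)
      qed simp
      have "card (A - {a}) < card A" using a finA by (intro psubset_card_mono) auto
      then have "\<exists>g. inj_on g (A - {a}) \<and> (\<forall>x\<in>A - {a}. g x \<in> N x - {b})"
        by (rule IH) (use finA finN hall' in auto)
      then obtain g where g: "inj_on g (A - {a})" "\<forall>x\<in>A - {a}. g x \<in> N x - {b}" by blast
      have "inj_on (g(a := b)) A" using g unfolding inj_on_def by auto
      moreover have "\<forall>x\<in>A. (g(a := b)) x \<in> N x" using g b by auto
      ultimately show ?thesis by blast
    qed
  qed
qed

text \<open>Adding the same k dummy partners to every \<open>N a\<close> restores Hall's condition;
  at most k elements are then matched to a dummy, and these are dropped.\<close>

lemma hall_marriage_deficiency:
  assumes "finite A" "\<And>a. a \<in> A \<Longrightarrow> finite (N a)"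
    and "\<And>S. S \<subseteq> A \<Longrightarrow> card S \<le> card (\<Union> (N ` S)) + k"
  obtains f B where "B \<subseteq> A" "inj_on f B" "\<And>a. a \<in> B \<Longrightarrow> f a \<in> N a" "card (A - B) \<le> k"
proof -
  define N' where "N' a = Inl ` N a \<union> Inr ` {..<k}" for a
  have "card S \<le> card (\<Union> (N' ` S))" if S: "S \<subseteq> A" for S
  proof (cases "S = {}")
    case False
    have "\<Union> (N' ` S) = Inl ` (\<Union> (N ` S)) \<union> Inr ` {..<k}" using False by (auto simp: N'_def)
    moreover have "finite (\<Union> (N ` S))"
      using that assms by (meson finite_UN_I finite_subset subsetD)
    ultimately have "card (\<Union> (N' ` S)) = card (\<Union> (N ` S)) + k"
      by (simp only:, subst card_Un_disjoint) (auto simp: card_image)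
    then show ?thesis using assms(3) S by simp
  qed simp
  then have "\<exists>f. inj_on f A \<and> (\<forall>a\<in>A. f a \<in> N' a)"
    using assms by (intro hall_marriage) (auto simp: N'_def)
  then obtain f where f: "inj_on f A" "\<forall>a\<in>A. f a \<in> N' a" by blast
  define B where "B = {a \<in> A. f a \<in> range Inl}"
  have "inj_on (projl \<circ> f) B"
    using f by (auto simp: B_def inj_on_def)
  moreover have "(projl \<circ> f) a \<in> N a" if "a \<in> B" for a
    using that f by (auto simp: B_def N'_def)
  moreover have "card (A - B) \<le> k"
  proof -
    have "f ` (A - B) \<subseteq> Inr ` {..<k}" using f by (auto simp: B_def N'_def)
    then have "card (f ` (A - B)) \<le> card (Inr ` {..<k} :: ('b + nat) set)"
      by (intro card_mono) auto
    moreover have "inj_on f (A - B)" using f inj_on_diff by blast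
    ultimately show ?thesis by (simp add: card_image)
  qed
  ultimately show ?thesis using that[of B "projl \<circ> f"] by (auto simp: B_def)
qed

section \<open>Paths and cycles as lists, matchings as relations\<close>

definition is_path :: "'a rel \<Rightarrow> 'a list \<Rightarrow> bool" where
  "is_path E xs \<longleftrightarrow> distinct xs \<and> successively (\<lambda>x y. (x, y) \<in> E) xs"

definition is_cycle :: "'a rel \<Rightarrow> 'a list \<Rightarrow> bool" where
  "is_cycle E xs \<longleftrightarrow> is_path E xs \<and> 3 \<le> length xs \<and> (last xs, hd xs) \<in> E"

definition short_cycle_verts :: "'a rel \<Rightarrow> nat \<Rightarrow> 'a set" where
  "short_cycle_verts E k = {v. \<exists>xs. is_cycle E xs \<and> length xs \<le> k \<and> v \<in> set xs}"

definition simple_graph :: "'a set \<Rightarrow> 'a rel \<Rightarrow> bool" where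
  "simple_graph V E \<longleftrightarrow> finite V \<and> E \<subseteq> V \<times> V \<and> sym E \<and> irrefl E"

text \<open>Matchings have the type of the edge relation: \<open>Domain M\<close> is the set of
  covered vertices and \<open>E - M\<close> is again a symmetric relation. Loops are excluded by
  \<open>M \<subseteq> E\<close> wherever E is irreflexive.\<close>

definition matching :: "'a rel \<Rightarrow> bool" where
  "matching M \<longleftrightarrow> sym M \<and> single_valued M"

lemma is_path_mono: "is_path E xs \<Longrightarrow> E \<subseteq> E' \<Longrightarrow> is_path E' xs"
  by (auto simp: is_path_def elim: successively_mono)

lemma is_cycle_mono: "is_cycle E xs \<Longrightarrow> E \<subseteq> E' \<Longrightarrow> is_cycle E' xs"
  by (auto simp: is_cycle_def dest: is_path_mono)

lemma short_cycle_verts_mono: "E \<subseteq> E' \<Longrightarrow> short_cycle_verts E k \<subseteq> short_cycle_verts E' k"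
  by (auto simp: short_cycle_verts_def dest: is_cycle_mono)

lemma short_cycle_verts_subset:
  assumes "E \<subseteq> V \<times> V" shows "short_cycle_verts E k \<subseteq> V"
proof
  fix v assume "v \<in> short_cycle_verts E k"
  then obtain xs where xs: "is_cycle E xs" "v \<in> set xs" by (auto simp: short_cycle_verts_def)
  then obtain i where i: "i < length xs" "v = xs ! i" by (auto simp: in_set_conv_nth)
  have L: "(xs ! j, xs ! Suc j) \<in> E" if "Suc j < length xs" for j
    using xs that by (auto simp: is_cycle_def is_path_def successively_conv_nth)
  show "v \<in> V"
  proof (cases "Suc i < length xs")
    case True then show ?thesis using L[of i] i assms by auto
  next
    case False
    then have "Suc (i - 1) = i" "i - 1 < length xs" using xs i by (auto simp: is_cycle_def)
    then show ?thesis using L[of "i - 1"] i assms by auto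
  qed
qed

lemma matching_UN_disjoint:
  assumes "matching M" "matching M'" "Domain M \<inter> Domain M' = {}"
  shows "matching (M \<union> M')"
proof -
  have "sym (M \<union> M')" using assms by (simp add: matching_def sym_Un)
  moreover have "single_valued (M \<union> M')"
  proof (rule single_valuedI)
    fix x y z assume "(x, y) \<in> M \<union> M'" "(x, z) \<in> M \<union> M'"
    then consider "(x, y) \<in> M" "(x, z) \<in> M" | "(x, y) \<in> M'" "(x, z) \<in> M'"
      using assms(3) by blast
    then show "y = z" using assms(1,2) by cases (auto simp: matching_def dest: single_valuedD)
  qed
  ultimately show ?thesis by (simp add: matching_def)
qed

lemma path_near_perfect_matching:
  assumes "is_path E xs" "sym E"
  shows "\<exists>M \<subseteq> E. matching M \<and> M \<subseteq> set xs \<times> set xs \<and> card (set xs - Domain M) \<le> 1"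
  using assms
proof (induction xs rule: induct_list012)
  case 1 then show ?case by (intro exI[of _ "{}"]) (auto simp: matching_def sym_def)
next
  case (2 x) then show ?case by (intro exI[of _ "{}"]) (auto simp: matching_def sym_def)
next
  case (3 x y zs)
  have "is_path E zs" using "3.prems" by (cases zs) (auto simp: is_path_def)
  with 3 obtain M where M: "M \<subseteq> E" "matching M" "M \<subseteq> set zs \<times> set zs"
    "card (set zs - Domain M) \<le> 1" by blast
  define M' where "M' = {(x, y), (y, x)}"
  have xy: "x \<noteq> y" "x \<notin> set zs" "y \<notin> set zs" "(x, y) \<in> E" "(y, x) \<in> E"
    using "3.prems" by (auto simp: is_path_def dest: symD)
  have "matching M'" using xy by (auto simp: matching_def M'_def sym_def single_valued_def)
  moreover have "Domain M' \<inter> Domain M = {}" using M xy by (auto simp: M'_def)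
  ultimately have "matching (M' \<union> M)" using M matching_UN_disjoint by blast
  moreover have "set (x # y # zs) - Domain (M' \<union> M) = set zs - Domain M"
    using xy by (auto simp: M'_def)
  ultimately show ?case using M xy by (intro exI[of _ "M' \<union> M"]) (auto simp: M'_def)
qed

section \<open>Nearly perfect matchings\<close>

lemma funpow_cycle:
  assumes "finite W" "inj_on f W" "f ` W \<subseteq> W" "v \<in> W"
  obtains l where "0 < l" "(f ^^ l) v = v" "inj_on (\<lambda>i. (f ^^ i) v) {..<l}"
proof -
  have W: "(f ^^ i) v \<in> W" for i using assms by (induction i) auto
  have cancel: "i \<le> j \<Longrightarrow> (f ^^ i) v = (f ^^ j) v \<Longrightarrow> (f ^^ (j - i)) v = v" for i j
  proof (induction i arbitrary: j)
    case (Suc i)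
    then obtain j' where j: "j = Suc j'" by (cases j) auto
    with Suc have "f ((f ^^ i) v) = f ((f ^^ j') v)" by simp
    then have "(f ^^ i) v = (f ^^ j') v" using W assms(2) by (auto dest: inj_onD)
    with Suc j show ?case by simp
  qed simp
  have "\<not> inj_on (\<lambda>i. (f ^^ i) v) {..card W}"
  proof
    assume "inj_on (\<lambda>i. (f ^^ i) v) {..card W}"
    then have "card {..card W} \<le> card W" using W assms(1) by (intro card_inj_on_le) auto
    then show False by simp
  qed
  then obtain i j where "i < j" "(f ^^ i) v = (f ^^ j) v"
    unfolding inj_on_def by (metis nat_neq_iff)
  then have ex: "0 < j - i \<and> (f ^^ (j - i)) v = v" using cancel[of i j] by simp
  define l where "l = (LEAST l. 0 < l \<and> (f ^^ l) v = v)"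
  have l: "0 < l" "(f ^^ l) v = v" using LeastI[of "\<lambda>l. 0 < l \<and> (f ^^ l) v = v", OF ex]
    by (auto simp: l_def)
  have min: "(f ^^ k) v \<noteq> v" if "0 < k" "k < l" for k
    using not_less_Least[of k "\<lambda>l. 0 < l \<and> (f ^^ l) v = v"] that by (auto simp: l_def)
  have "a = b" if "a < l" "b < l" "(f ^^ a) v = (f ^^ b) v" for a b
  proof (rule ccontr)
    assume "a \<noteq> b"
    then consider "a < b" | "b < a" by linarith
    then show False
      using cancel[of a b] cancel[of b a] min[of "b - a"] min[of "a - b"] that by cases auto
  qed
  then have "inj_on (\<lambda>i. (f ^^ i) v) {..<l}" by (intro inj_onI) auto
  with l show ?thesis using that by blast
qed

text \<open>Orbits of f are peeled off. A vertex v of B without preimage, or on a 2-cycle, is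
  matched with \<open>f v\<close>, and both are removed. If no such v is left, f permutes B, so a
  vertex outside B has no preimage and can be given up, at the cost of one unit of
  \<open>card (W - B)\<close>. If B = W, all cycles of f have length at least 3 and each gives up at
  most one vertex, paid for by \<open>short_cycle_verts\<close> if the length is at most K and by
  \<open>card W / K\<close> otherwise.\<close>

lemma partial_injection_matching:
  assumes "finite W" "B \<subseteq> W" "inj_on f B" "f ` B \<subseteq> W" "\<And>v. v \<in> B \<Longrightarrow> (v, f v) \<in> E"
    and E: "sym E" "irrefl E" and K: "0 < K"
  shows "\<exists>M \<subseteq> E. matching M \<and> M \<subseteq> W \<times> W \<and>
    real (card (W - Domain M)) \<le>
      real (card (W - B)) + real (card (W \<inter> short_cycle_verts E K)) + real (card W) / real K"
  using assms(1-5)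
proof (induction "card W" arbitrary: W B rule: less_induct)
  case less
  define Z where "Z = short_cycle_verts E K"
  show ?case
  proof (cases "W = {}")
    case True
    then show ?thesis by (intro exI[of _ "{}"]) (auto simp: matching_def sym_def)
  next
    case ne: False
    have finW: "finite W" and BW: "B \<subseteq> W" by fact+
    \<comment> \<open>Since f maps nothing from outside C into C, it restricts to a partial
      injection on W - C; and all terms of the bound are additive over C and W - C.\<close>
    have step: ?thesis
      if C: "C \<subseteq> W" "C \<noteq> {}" "f ` (B - C) \<inter> C = {}"
        and N: "N \<subseteq> E" "matching N" "N \<subseteq> C \<times> C"
        and bnd: "real (card (C - Domain N))
          \<le> real (card (C - B)) + real (card (C \<inter> Z)) + real (card C) / real K" for C N
    proof -
      have "card (W - C) < card W" using C finW by (intro psubset_card_mono) auto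
      moreover have "f ` (B - C) \<subseteq> W - C" using C less.prems by auto
      moreover have "inj_on f (B - C)" using less.prems inj_on_diff by blast
      ultimately obtain M where M: "M \<subseteq> E" "matching M" "M \<subseteq> (W - C) \<times> (W - C)"
        "real (card (W - C - Domain M)) \<le> real (card (W - C - (B - C)))
          + real (card ((W - C) \<inter> Z)) + real (card (W - C)) / real K"
        using less.hyps[of "W - C" "B - C"] less.prems unfolding Z_def by auto
      have fin: "finite C" using C finW finite_subset by blast
      have split: "real (card (W \<inter> X)) = real (card (C \<inter> X)) + real (card ((W - C) \<inter> X))" for X
      proof -
        have "W \<inter> X = (C \<inter> X) \<union> ((W - C) \<inter> X)" using C by auto
        moreover have "card ((C \<inter> X) \<union> ((W - C) \<inter> X)) = card (C \<inter> X) + card ((W - C) \<inter> X)"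
          using fin finW by (intro card_Un_disjoint) auto
        ultimately show ?thesis by simp
      qed
      have dom: "Domain N \<subseteq> C" "Domain M \<subseteq> W - C" using N M by auto
      have "W - Domain (N \<union> M) = W \<inter> - Domain (N \<union> M)" by auto
      moreover have "C \<inter> - Domain (N \<union> M) = C - Domain N" using dom by auto
      moreover have "(W - C) \<inter> - Domain (N \<union> M) = W - C - Domain M" using dom by auto
      ultimately have "real (card (W - Domain (N \<union> M)))
          = real (card (C - Domain N)) + real (card (W - C - Domain M))"
        using split[of "- Domain (N \<union> M)"] by simp
      moreover have "real (card (W - B)) = real (card (C - B)) + real (card (W - C - (B - C)))"
      proof -
        have "W - C - (B - C) = (W - C) \<inter> - B" by auto
        then show ?thesis using split[of "- B"] by (simp add: Diff_eq)
      qed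
      moreover have "real (card W) = real (card C) + real (card (W - C))"
        using split[of UNIV] C by (simp add: Int_absorb1)
      ultimately have "real (card (W - Domain (N \<union> M))) \<le>
          real (card (W - B)) + real (card (W \<inter> Z)) + real (card W) / real K"
        using M(4) bnd split[of Z] by (simp add: add_divide_distrib)
      moreover have "matching (N \<union> M)"
        using N M dom by (intro matching_UN_disjoint) auto
      ultimately show ?thesis
        using N M C unfolding Z_def by (intro exI[of _ "N \<union> M"]) auto
    qed
    show ?thesis
    proof (cases "\<exists>v\<in>B. v \<notin> f ` B \<or> f v \<in> B \<and> f (f v) = v")
      case True
      then obtain v where v: "v \<in> B" "v \<notin> f ` B \<or> f v \<in> B \<and> f (f v) = v" by blast
      define C where "C = {v, f v}"
      define N where "N = {(v, f v), (f v, v)}"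
      have vE1: "(v, f v) \<in> E" using v less.prems by blast
      with E have vE: "(v, f v) \<in> E" "(f v, v) \<in> E" "v \<noteq> f v"
        by (auto dest: symD irreflD)
      have "f ` (B - C) \<inter> C = {}"
      proof -
        have "False" if "a \<in> B" "a \<noteq> v" "a \<noteq> f v" "f a = v" for a
          using that v(2) inj_onD[OF less.prems(3), of a "f v"] by auto
        moreover have "False" if "a \<in> B" "a \<noteq> v" "f a = f v" for a
          using that v(1) inj_onD[OF less.prems(3), of a v] by auto
        ultimately show ?thesis unfolding C_def by blast
      qed
      moreover have "matching N" "Domain N = C" "N \<subseteq> C \<times> C"
        using vE by (auto simp: N_def C_def matching_def sym_def single_valued_def)
      ultimately show ?thesis
        using v less.prems vE by (intro step[of C N]) (auto simp: C_def N_def)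
    next
      case False
      then have BsubfB: "B \<subseteq> f ` B" by blast
      show ?thesis
      proof (cases "B = W")
        case BW': False
        then obtain v where v: "v \<in> W" "v \<notin> B" using BW by blast
        have "f ` B = B"
          using BsubfB less.prems finite_subset[OF BW finW]
          by (metis card_image card_subset_eq finite_imageI)
        moreover have "{v} - B = {v}" using v by auto
        ultimately show ?thesis using v
          by (intro step[of "{v}" "{}"]) (auto simp: matching_def sym_def)
      next
        case True
        obtain v where v: "v \<in> W" using ne by blast
        obtain l where l: "0 < l" "(f ^^ l) v = v" "inj_on (\<lambda>i. (f ^^ i) v) {..<l}"
          using funpow_cycle[of W f v] finW less.prems True v by blast
        define xs where "xs = map (\<lambda>i. (f ^^ i) v) [0..<l]"
        have W: "(f ^^ i) v \<in> W" for i using less.prems(4) True v by (induction i) auto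
        have len: "length xs = l" by (simp add: xs_def)
        have dist: "distinct xs" using l(3) by (simp add: xs_def distinct_map atLeast0LessThan)
        have path: "is_path E xs"
          using dist less.prems(5) True W by (auto simp: is_path_def successively_conv_nth xs_def)
        have "(v, f v) \<in> E" using less.prems(5)[of v] True v by simp
        then have "v \<noteq> f v" using E by (auto dest: irreflD)
        then have "l \<noteq> 1" using l by auto
        moreover have "l \<noteq> 2" using False l True v less.prems(4) by (auto simp: numeral_2_eq_2)
        ultimately have l3: "3 \<le> l" using l by linarith
        have "(f ((f ^^ (l - 1)) v)) = (f ^^ Suc (l - 1)) v" by simp
        then have fl: "f ((f ^^ (l - 1)) v) = v" using l by simp
        then have "((f ^^ (l - 1)) v, v) \<in> E"
          using less.prems(5)[of "(f ^^ (l - 1)) v"] W True by simp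
        moreover have "last xs = (f ^^ (l - 1)) v" "hd xs = v"
          using l by (auto simp: xs_def last_map hd_map)
        ultimately have cyc: "is_cycle E xs" using path l3 len by (simp add: is_cycle_def)
        have set_xs: "set xs = (\<lambda>i. (f ^^ i) v) ` {..<l}" by (auto simp: xs_def)
        have inv: "f ` (B - set xs) \<inter> set xs = {}"
        proof -
          have "a \<in> set xs" if a: "a \<in> W" "f a \<in> set xs" for a
          proof -
            obtain i where i: "i < l" "f a = (f ^^ i) v" using a set_xs by auto
            define i' where "i' = (if i = 0 then l - 1 else i - 1)"
            have "f ((f ^^ i') v) = f a"
            proof (cases i)
              case 0 then show ?thesis using i fl by (simp add: i'_def)
            next
              case (Suc m) then show ?thesis using i by (simp add: i'_def)
            qed
            then have "a = (f ^^ i') v" using less.prems(3) True a W by (metis inj_onD)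
            moreover have "i' < l" using i l by (auto simp: i'_def)
            ultimately show ?thesis using set_xs by auto
          qed
          then show ?thesis using True by auto
        qed
        obtain N where N: "N \<subseteq> E" "matching N" "N \<subseteq> set xs \<times> set xs"
          "card (set xs - Domain N) \<le> 1"
          using path_near_perfect_matching[OF path E(1)] by blast
        have "1 \<le> real (card (set xs \<inter> Z)) + real (card (set xs)) / real K"
        proof (cases "l \<le> K")
          case True
          then have "set xs \<subseteq> Z" using cyc len by (auto simp: Z_def short_cycle_verts_def)
          then have "card (set xs \<inter> Z) = l" using dist len
            by (simp add: Int_absorb2 distinct_card)
          then have "1 \<le> real (card (set xs \<inter> Z))" using l by simp
          moreover have "0 \<le> real (card (set xs)) / real K" by simp
          ultimately show ?thesis by linarith
        next
          case False
          then have "1 \<le> real (card (set xs)) / real K"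
            using dist len K by (simp add: distinct_card)
          then show ?thesis by linarith
        qed
        then have "real (card (set xs - Domain N)) \<le> real (card (set xs - B))
            + real (card (set xs \<inter> Z)) + real (card (set xs)) / real K"
          using N(4) by linarith
        moreover have "set xs \<subseteq> W" "set xs \<noteq> {}" using W l by (auto simp: set_xs)
        ultimately show ?thesis using inv N by (intro step[of "set xs" N]) auto
      qed
    qed
  qed
qed

lemma near_perfect_matching:
  assumes G: "simple_graph V E" and "0 < K"
    and exp: "\<And>S. S \<subseteq> V \<Longrightarrow> card S \<le> card (E `` S) + k"
  obtains M where "M \<subseteq> E" "matching M"
    "real (card (V - Domain M))
      \<le> real k + real (card (short_cycle_verts E K)) + real (card V) / real K"
proof -
  have fin: "finite V" and EV: "E \<subseteq> V \<times> V" and E: "sym E" "irrefl E"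
    using G by (auto simp: simple_graph_def)
  have finE: "finite (E `` S)" for S
    using finite_subset[OF _ fin, of "E `` S"] EV by blast
  have exp': "card S \<le> card (\<Union>a\<in>S. E `` {a}) + k" if "S \<subseteq> V" for S
    using exp[OF that] by (simp add: Image_eq_UN[of E S])
  obtain f B where B: "B \<subseteq> V" "inj_on f B" "\<And>a. a \<in> B \<Longrightarrow> f a \<in> E `` {a}" "card (V - B) \<le> k"
    by (rule hall_marriage_deficiency[of V "\<lambda>v. E `` {v}" k, OF fin finE exp']) (assumption, rule that)
  have "f ` B \<subseteq> V" using B EV by auto
  then obtain M where M: "M \<subseteq> E" "matching M" "real (card (V - Domain M))
      \<le> real (card (V - B)) + real (card (V \<inter> short_cycle_verts E K)) + real (card V) / real K"
    using partial_injection_matching[of V B f E K] B fin E assms(2) by auto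
  have "V \<inter> short_cycle_verts E K = short_cycle_verts E K"
    using short_cycle_verts_subset[OF EV] by blast
  with M B(4) show ?thesis by (intro that[of M]) auto
qed

text \<open>Counting arcs: at least \<open>D * card S\<close> of them leave S, all of them end in
  \<open>E\<close> S\<open>, and the vertices there carry at most\<close>D * card (E
  \<open>S) + k\<close> arcs.\<close>

lemma nearly_regular_expansion:
  assumes G: "simple_graph V E" and D: "0 < D" "\<And>v. v \<in> V \<Longrightarrow> D \<le> card (E `` {v})"
    and k: "(\<Sum>v\<in>V. card (E `` {v}) - D) \<le> k" and S: "S \<subseteq> V"
  shows "card S \<le> card (E `` S) + k"
proof -
  have fin: "finite V" and EV: "E \<subseteq> V \<times> V" and E: "sym E"
    using G by (auto simp: simple_graph_def)
  have finE: "finite (E `` T)" for T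
    using finite_subset[OF _ fin, of "E `` T"] EV by blast
  have finS: "finite S" using S fin finite_subset by blast
  have TV: "E `` S \<subseteq> V" using EV by blast
  have "D * card S = (\<Sum>v\<in>S. D)" by simp
  also have "\<dots> \<le> (\<Sum>v\<in>S. card (E `` {v}))" using D S by (intro sum_mono) auto
  also have "\<dots> = card (SIGMA v:S. E `` {v})" using finS finE by (simp add: card_SigmaI)
  also have "\<dots> \<le> card (prod.swap ` (SIGMA v:E `` S. E `` {v}))"
  proof (rule card_mono)
    show "(SIGMA v:S. E `` {v}) \<subseteq> prod.swap ` (SIGMA v:E `` S. E `` {v})"
      using E by (force simp: image_iff dest: symD)
  qed (use finE in auto)
  also have "\<dots> = (\<Sum>v\<in>E `` S. card (E `` {v}))"
    using finE by (subst card_image) (auto simp: card_SigmaI)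
  also have "\<dots> \<le> (\<Sum>v\<in>E `` S. D + (card (E `` {v}) - D))" by (intro sum_mono) auto
  also have "\<dots> = D * card (E `` S) + (\<Sum>v\<in>E `` S. card (E `` {v}) - D)"
    by (simp add: sum.distrib)
  also have "(\<Sum>v\<in>E `` S. card (E `` {v}) - D) \<le> (\<Sum>v\<in>V. card (E `` {v}) - D)"
    using TV fin by (intro sum_mono2) auto
  finally have "D * card S \<le> D * card (E `` S) + k" using k by linarith
  also have "\<dots> \<le> D * (card (E `` S) + k)" using D by (simp add: algebra_simps)
  finally show ?thesis using D by simp
qed

section \<open>Path covers\<close>

definition path_cover :: "'a set \<Rightarrow> 'a rel \<Rightarrow> 'a list set \<Rightarrow> bool" where
  "path_cover V F P \<longleftrightarrow> finite P \<and> (\<Union>p\<in>P. set p) = V \<and>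
    (\<forall>p\<in>P. p \<noteq> [] \<and> is_path F p) \<and> (\<forall>p\<in>P. \<forall>q\<in>P. p \<noteq> q \<longrightarrow> set p \<inter> set q = {})"

lemma is_path_append:
  assumes "is_path F p" "is_path F q" "set p \<inter> set q = {}" "p \<noteq> []" "q \<noteq> []" "(last p, hd q) \<in> F"
  shows "is_path F (p @ q)"
  using assms by (auto simp: is_path_def successively_append_iff)

lemma is_path_rev: "sym F \<Longrightarrow> is_path F p \<Longrightarrow> is_path F (rev p)"
  by (auto simp: is_path_def elim: successively_mono dest: symD)

lemma path_cover_merge:
  assumes P: "path_cover V F P" "p \<in> P" "q \<in> P" "p \<noteq> q"
    and r: "is_path F r" "set r = set p \<union> set q"
  shows "path_cover V F (insert r (P - {p, q}))" "card (insert r (P - {p, q})) < card P"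
proof -
  have fin: "finite P" and pq: "p \<noteq> []" using P by (auto simp: path_cover_def)
  have disj: "set s \<inter> set r = {}" if "s \<in> P - {p, q}" for s
  proof -
    have "s \<in> P" "s \<noteq> p" "s \<noteq> q" using that by auto
    then have "set s \<inter> set p = {}" "set s \<inter> set q = {}" using P unfolding path_cover_def by metis+
    then show ?thesis using r(2) by auto
  qed
  have "r \<noteq> []" using r pq by auto
  moreover have "(\<Union>s\<in>insert r (P - {p, q}). set s) = V"
    using P r by (auto simp: path_cover_def)
  moreover have "set s \<inter> set t = {}"
    if "s \<in> insert r (P - {p, q})" "t \<in> insert r (P - {p, q})" "s \<noteq> t" for s t
  proof (cases "s = r \<or> t = r")
    case True
    then show ?thesis using that disj[of s] disj[of t] by (auto simp: Int_commute)
  next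
    case False
    then have "s \<in> P" "t \<in> P" using that by auto
    then show ?thesis using P(1) that(3) unfolding path_cover_def by metis
  qed
  moreover have "s \<noteq> [] \<and> is_path F s" if "s \<in> P" for s
    using P(1) that by (simp add: path_cover_def)
  ultimately show "path_cover V F (insert r (P - {p, q}))"
    using r(1) fin unfolding path_cover_def by (intro conjI ballI impI) auto
  have "card (insert r (P - {p, q})) \<le> Suc (card (P - {p, q}))"
    using fin by (simp add: card_insert_if)
  also have "card (P - {p, q}) = card P - 2"
    using P fin by (subst card_Diff_subset) auto
  also have "card {p, q} \<le> card P" using P fin by (intro card_mono) auto
  then have "Suc (card P - 2) < card P" using P by auto
  finally show "card (insert r (P - {p, q})) < card P" .
qed

lemma two_matchings_degree:
  assumes "matching M1" "matching M2"
    and "(y, a) \<in> M1 \<union> M2" "(y, b) \<in> M1 \<union> M2" "(y, c) \<in> M1 \<union> M2"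
  shows "a = b \<or> b = c \<or> a = c"
  using assms unfolding matching_def by (auto dest: single_valuedD)

text \<open>
  A neighbour of \<open>hd p\<close> other than its successor is not an inner vertex of a path, since that vertex
  would have degree 3; so it ends another path, which could be merged with \<open>p\<close>, or closes \<open>p\<close>.
\<close>
lemma minimal_path_cover_end:
  assumes P: "path_cover V F P" and min: "\<And>Q. path_cover V F Q \<Longrightarrow> card P \<le> card Q"
    and F: "F = M1 \<union> M2" "matching M1" "matching M2" "M1 \<inter> M2 = {}" "F \<subseteq> V \<times> V" "irrefl F"
    and p: "p \<in> P"
  shows "is_cycle F p \<or> hd p \<notin> Domain M1 \<or> hd p \<notin> Domain M2"
proof (rule ccontr)
  assume neg: "\<not> ?thesis"
  have symF: "sym F" using F by (auto simp: matching_def sym_Un)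
  have deg: "a = b \<or> b = c \<or> a = c" if "(y, a) \<in> F" "(y, b) \<in> F" "(y, c) \<in> F" for y a b c
    using two_matchings_degree[of M1 M2 y a b c] F that by auto
  have adj: "(q ! i, q ! Suc i) \<in> F" if "q \<in> P" "Suc i < length q" for q i
    using P that by (auto simp: path_cover_def is_path_def successively_conv_nth)
  have dist: "distinct q" "q \<noteq> []" if "q \<in> P" for q
    using P that by (auto simp: path_cover_def is_path_def)
  define x where "x = hd p"
  have xp: "x = p ! 0" "x \<in> set p" using dist[OF p] by (auto simp: x_def hd_conv_nth)
  obtain y1 y2 where y12: "(x, y1) \<in> M1" "(x, y2) \<in> M2" using neg by (auto simp: x_def)
  then have "y1 \<noteq> y2" using F by auto
  \<comment> \<open>The partners of x in the two matchings differ, so at least one of them is not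
    the successor of x on p.\<close>
  obtain y where y: "(x, y) \<in> F" "\<not> (1 < length p \<and> p ! 1 = y)"
  proof (cases "1 < length p \<and> p ! 1 = y1")
    case True
    then show ?thesis using that[of y2] y12 \<open>y1 \<noteq> y2\<close> F by auto
  next
    case False
    then show ?thesis using that[of y1] y12 F by auto
  qed
  then have "x \<noteq> y" using F by (auto dest: irreflD)
  have yx: "(y, x) \<in> F" using y symF by (auto dest: symD)
  have "y \<in> V" using y F by auto
  then obtain q where q: "q \<in> P" "y \<in> set q" using P by (auto simp: path_cover_def)
  then obtain i where i: "i < length q" "y = q ! i" by (auto simp: in_set_conv_nth)
  \<comment> \<open>The exception \<open>i = 1\<close> on p itself is y being the successor of x,
    which the choice of y rules out.\<close>
  have inner: "q = p \<and> i \<le> 1" if "0 < i" "Suc i < length q"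
  proof -
    have "(q ! i, q ! Suc i) \<in> F" using adj q that by blast
    moreover have "(q ! (i - 1), q ! i) \<in> F" using adj[of q "i - 1"] q that by simp
    then have "(q ! i, q ! (i - 1)) \<in> F" using symF by (auto dest: symD)
    moreover have "q ! Suc i \<noteq> q ! (i - 1)"
      using dist[OF q(1)] that by (simp add: nth_eq_iff_index_eq)
    ultimately have "x = q ! Suc i \<or> x = q ! (i - 1)"
      using deg[of y "q ! Suc i" "q ! (i - 1)" x] yx i by auto
    then have "x \<in> set q" using that by auto
    then have "q = p" using P p q(1) xp(2) unfolding path_cover_def by blast
    moreover have "i \<le> 1"
      using \<open>x = q ! Suc i \<or> x = q ! (i - 1)\<close> xp \<open>q = p\<close> dist[OF p] that
      by (auto simp: nth_eq_iff_index_eq)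
    ultimately show ?thesis by simp
  qed
  show False
  proof (cases "q = p")
    case True
    have "i \<noteq> 0" using True i xp(1) \<open>x \<noteq> y\<close> by metis
    moreover have "i \<noteq> 1" using True i y by auto
    ultimately have "i = length p - 1" "2 \<le> i" using inner True i by force+
    then have "last p = y" "3 \<le> length p" using i True dist[OF p] by (auto simp: last_conv_nth)
    then have "is_cycle F p" using yx P p by (auto simp: is_cycle_def path_cover_def x_def)
    then show False using neg by simp
  next
    case False
    have paths: "is_path F p" "is_path F q" "set p \<inter> set q = {}"
      using P p q False by (auto simp: path_cover_def)
    consider "i = 0" | "i = length q - 1" using inner False i by force
    then obtain r where "is_path F r" "set r = set p \<union> set q"
    proof cases
      case 1
      then have "is_path F (rev p @ q)"
        using paths is_path_rev[OF symF] dist[OF p] dist[OF q(1)] y i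
        by (intro is_path_append) (auto simp: last_rev x_def hd_conv_nth)
      then show ?thesis using that[of "rev p @ q"] by simp
    next
      case 2
      then have "is_path F (q @ p)"
        using paths dist[OF p] dist[OF q(1)] yx i
        by (intro is_path_append) (auto simp: x_def last_conv_nth)
      then show ?thesis using that[of "q @ p"] by auto
    qed
    then show False
      using path_cover_merge[OF P p q(1)] min False by (metis not_le)
  qed
qed

text \<open>In a cover by paths of M1 \<union> M2 with the fewest paths, each path is charged once:
  to its head if a matching misses it, to a vertex of a short cycle if the path closes to a cycle of
  length at most K, and otherwise to its own more than K vertices.\<close>

lemma two_matchings_path_cover:
  assumes G: "simple_graph V E" and M: "M1 \<subseteq> E" "M2 \<subseteq> E" "matching M1" "matching M2" "M1 \<inter> M2 = {}"
    and K: "0 < K"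
  obtains P where "path_cover V E P" "real (card P) \<le> real (card (V - Domain M1))
    + real (card (V - Domain M2)) + real (card (short_cycle_verts E K)) + real (card V) / real K"
proof -
  define F where "F = M1 \<union> M2"
  have fin: "finite V" and EV: "E \<subseteq> V \<times> V" and E: "sym E" "irrefl E"
    using G by (auto simp: simple_graph_def)
  have FE: "F \<subseteq> E" using M by (auto simp: F_def)
  have "irrefl F" using FE E by (auto simp: irrefl_def)
  have "path_cover V F ((\<lambda>v. [v]) ` V)"
    using fin by (auto simp: path_cover_def is_path_def)
  then obtain P where P: "path_cover V F P" "\<And>Q. path_cover V F Q \<Longrightarrow> card P \<le> card Q"
    using ex_has_least_nat[of "path_cover V F" _ card] by blast
  have finP: "finite P" using P by (simp add: path_cover_def)
  define Z where "Z = short_cycle_verts E K"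
  have ZV: "Z \<subseteq> V" unfolding Z_def by (rule short_cycle_verts_subset) fact
  then have finZ: "finite Z" using fin finite_subset by blast
  have hd_set: "hd p \<in> set p" if "p \<in> P" for p using P that by (auto simp: path_cover_def)
  have hdV: "hd p \<in> V" if "p \<in> P" for p using P that hd_set[OF that] by (auto simp: path_cover_def)
  have hd_inj: "inj_on hd P"
    using P hd_set unfolding path_cover_def inj_on_def by (metis disjoint_iff)
  define A where "A = {p \<in> P. hd p \<in> (V - Domain M1) \<union> (V - Domain M2)}"
  define B where "B = {p \<in> P. is_cycle F p \<and> length p \<le> K}"
  define C where "C = {p \<in> P. K < length p}"
  have "P = A \<union> B \<union> C"
    using minimal_path_cover_end[OF P F_def M(3,4,5)] FE EV \<open>irrefl F\<close> hdV
    unfolding A_def B_def C_def by (auto simp: not_le[symmetric])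
  then have "card P \<le> card A + card B + card C"
    by (metis add.commute add_left_mono card_Un_le le_trans)
  moreover have "card A \<le> card (V - Domain M1) + card (V - Domain M2)"
  proof -
    have "card A \<le> card ((V - Domain M1) \<union> (V - Domain M2))"
      using fin hd_inj by (intro card_inj_on_le[of hd]) (auto simp: A_def elim: inj_on_subset)
    also have "\<dots> \<le> card (V - Domain M1) + card (V - Domain M2)" by (rule card_Un_le)
    finally show ?thesis .
  qed
  moreover have "card B \<le> card Z"
  proof (rule card_inj_on_le[of hd])
    show "inj_on hd B" using hd_inj by (auto simp: B_def elim: inj_on_subset)
    show "hd ` B \<subseteq> Z"
      using is_cycle_mono[OF _ FE] hd_set unfolding B_def Z_def short_cycle_verts_def by blast
  qed fact
  moreover have "real (card C) \<le> real (card V) / real K"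
  proof -
    have "K * card C = (\<Sum>p\<in>C. K)" by simp
    also have "\<dots> \<le> (\<Sum>p\<in>C. card (set p))"
      using P(1) by (intro sum_mono) (auto simp: C_def path_cover_def is_path_def distinct_card)
    also have "\<dots> = card (\<Union>p\<in>C. set p)"
      using P(1) finP by (subst card_UN_disjoint) (auto simp: C_def path_cover_def)
    also have "\<dots> \<le> card V" using P(1) fin by (intro card_mono) (auto simp: C_def path_cover_def)
    finally have "real (K * card C) \<le> real (card V)" using of_nat_le_iff by blast
    then show ?thesis using K by (simp add: field_simps)
  qed
  moreover have "path_cover V E P"
    using P(1) is_path_mono[OF _ FE] by (auto simp: path_cover_def)
  ultimately show ?thesis by (intro that[of P]) (auto simp: Z_def)
qed

text \<open>Let e be the sum in parentheses. The first matching misses at most e vertices. Exactly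
  these keep degree d in E - M1, an excess over d - 1 of at most e in total, so the second matching
  misses at most 2e. The cover itself costs e more, and 1 + 2 + 1 = 4.\<close>

lemma regular_path_cover:
  assumes G: "simple_graph V E" and reg: "\<And>v. v \<in> V \<Longrightarrow> card (E `` {v}) = d"
    and d: "2 \<le> d" and K: "0 < K"
  obtains P where "path_cover V E P"
    "real (card P) \<le> 4 * (real (card (short_cycle_verts E K)) + real (card V) / real K)"
proof -
  define e where "e = real (card (short_cycle_verts E K)) + real (card V) / real K"
  have fin: "finite V" and EV: "E \<subseteq> V \<times> V" and E: "sym E" "irrefl E"
    using G by (auto simp: simple_graph_def)
  have finE: "finite (E `` S)" for S
    using finite_subset[OF _ fin, of "E `` S"] EV by blast
  obtain M1 where M1: "M1 \<subseteq> E" "matching M1" "real (card (V - Domain M1)) \<le> e"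
  proof (rule near_perfect_matching[OF G K, of 0])
    show "card S \<le> card (E `` S) + 0" if "S \<subseteq> V" for S
      using d reg that by (intro nearly_regular_expansion[OF G, of d]) auto
  qed (auto simp: e_def)
  define E' where "E' = E - M1"
  have G': "simple_graph V E'"
    using G M1(2) by (auto simp: simple_graph_def E'_def matching_def sym_def irrefl_def)
  have deg': "card (E' `` {v}) = (if v \<in> Domain M1 then d - 1 else d)" if v: "v \<in> V" for v
  proof (cases "v \<in> Domain M1")
    case True
    then obtain w where w: "(v, w) \<in> M1" by auto
    then have "E' `` {v} = E `` {v} - {w}" "w \<in> E `` {v}"
      using M1 by (auto simp: E'_def matching_def dest: single_valuedD)
    then show ?thesis using True reg[OF v] finE by simp
  next
    case False
    then have "E' `` {v} = E `` {v}" by (auto simp: E'_def)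
    then show ?thesis using False reg[OF v] by simp
  qed
  have "(\<Sum>v\<in>V. card (E' `` {v}) - (d - 1)) = (\<Sum>v\<in>V. if v \<in> Domain M1 then 0 else 1)"
    using d by (intro sum.cong) (auto simp: deg')
  also have "\<dots> = card (V - Domain M1)"
    using fin by (simp add: sum.If_cases Diff_eq Int_commute)
  finally have excess: "(\<Sum>v\<in>V. card (E' `` {v}) - (d - 1)) \<le> card (V - Domain M1)" by simp
  obtain M2 where M2: "M2 \<subseteq> E'" "matching M2" "real (card (V - Domain M2))
      \<le> real (card (V - Domain M1)) + real (card (short_cycle_verts E' K)) + real (card V) / real K"
  proof (rule near_perfect_matching[OF G' K, of "card (V - Domain M1)"])
    show "card S \<le> card (E' `` S) + card (V - Domain M1)" if "S \<subseteq> V" for S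
      using d that by (intro nearly_regular_expansion[OF G', of "d - 1"] excess) (auto simp: deg')
  qed auto
  have "E' \<subseteq> E" by (auto simp: E'_def)
  then have "card (short_cycle_verts E' K) \<le> card (short_cycle_verts E K)"
    using finite_subset[OF short_cycle_verts_subset[OF EV] fin]
    by (intro card_mono short_cycle_verts_mono)
  then have "real (card (V - Domain M2)) \<le> 2 * e" using M1 M2 by (simp add: e_def)
  moreover have "M2 \<subseteq> E" "M1 \<inter> M2 = {}" using M2(1) by (auto simp: E'_def)
  then obtain P where "path_cover V E P" "real (card P) \<le> real (card (V - Domain M1))
    + real (card (V - Domain M2)) + real (card (short_cycle_verts E K)) + real (card V) / real K"
    by (rule two_matchings_path_cover[OF G M1(1) _ M1(2) M2(2) _ K])
  ultimately show ?thesis using M1 by (intro that[of P]) (auto simp: e_def)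
qed

section \<open>Forcing along a ranking\<close>

lemma pair_graph_neighbours:
  assumes "pair_graph G"
  shows "neighbours G v \<subseteq> pverts G" "u \<in> neighbours G v \<longleftrightarrow> v \<in> neighbours G u" "v \<notin> neighbours G v"
proof -
  interpret pair_graph G by fact
  show "neighbours G v \<subseteq> pverts G" by (auto simp: neighbours_def intro: in_arcsD2)
  show "u \<in> neighbours G v \<longleftrightarrow> v \<in> neighbours G u"
    by (auto simp: neighbours_def intro: arcs_symmetric)
  show "v \<notin> neighbours G v" by (auto simp: neighbours_def dest: no_loops')
qed

lemma hopping_number_le:
  assumes "hop_feasible G B"
  shows "hopping_number G \<le> card B"
  unfolding hopping_number_def using assms by (intro Least_le) blast

text \<open>
  The forces \<open>b u \<rightarrow> w u\<close> are performed in the order of the rank of \<open>u\<close>. A vertex that is still white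
  when \<open>u\<close> is due is some \<open>w u'\<close> with \<open>r u' \<ge> r u > r (b u)\<close>, hence not a neighbour of \<open>b u\<close>.
\<close>
lemma hopping_number_le_ranked_forces:
  fixes r :: "'a \<Rightarrow> nat"
  assumes G: "pair_graph G" and U: "U \<subseteq> pverts G" and inj: "inj_on b U"
    and b: "\<And>u. u \<in> U \<Longrightarrow> b u \<in> neighbours G u" "\<And>u. u \<in> U \<Longrightarrow> r (b u) < r u"
    and w: "\<And>u. u \<in> U \<Longrightarrow> w u \<in> neighbours G u"
      "\<And>u x. u \<in> U \<Longrightarrow> x \<in> insert (w u) (neighbours G (w u)) \<Longrightarrow> x \<noteq> u \<Longrightarrow> r u < r x"
  shows "hopping_number G + card U \<le> card (pverts G)"
proof -
  note N = pair_graph_neighbours[OF G]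
  interpret pair_graph G by fact
  have fin: "finite (pverts G)" by (rule pair_finite_verts)
  have finU: "finite U" using U fin finite_subset by blast
  have wV: "w u \<in> pverts G" if "u \<in> U" for u using w(1)[OF that] N(1) by blast
  have inj_w: "inj_on w U"
  proof (rule inj_onI, rule ccontr)
    fix u u' assume u: "u \<in> U" "u' \<in> U" "w u = w u'" "u \<noteq> u'"
    then have "r u < r u'" "r u' < r u" using w N(2) by (metis insertI2)+
    then show False by simp
  qed
  define B where "B = pverts G - w ` U"
  obtain us where us: "set us = U" "sorted (map r us)" "distinct us"
    using finU by (metis distinct_sort finite_distinct_list set_sort sorted_sort_key)
  have "(hop_step G)\<^sup>*\<^sup>* (B, {}) (B \<union> w ` set (take k us), b ` set (take k us))" if "k \<le> length us" for k
    using that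
  proof (induction k)
    case (Suc k)
    define u where "u = us ! k"
    have take: "set (take (Suc k) us) = insert u (set (take k us))"
      using Suc.prems by (simp add: take_Suc_conv_app_nth u_def)
    have uU: "u \<in> U" using us(1) Suc.prems by (auto simp: u_def)
    have unew: "u \<notin> set (take k us)"
      using us(3) Suc.prems by (auto simp: u_def in_set_conv_nth nth_eq_iff_index_eq)
    have done_U: "set (take k us) \<subseteq> U" using us(1) set_take_subset by fast
    have late: "r u \<le> r u'" if "u' \<in> U" "u' \<notin> set (take k us)" for u'
    proof -
      have "u' \<in> set us" using that(1) us(1) by simp
      then obtain j where j: "j < length us" "us ! j = u'" unfolding in_set_conv_nth by blast
      have "k \<le> j"
      proof (rule ccontr)
        assume "\<not> k \<le> j"
        then have "take k us ! j = u'" "j < length (take k us)" using j by auto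
        then show False using that(2) nth_mem by metis
      qed
      then show ?thesis using sorted_nth_mono[OF us(2), of k j] j Suc.prems by (simp add: u_def)
    qed
    have blue: "v \<in> B \<union> w ` set (take k us)"
      if v: "v \<in> pverts G" "v \<in> insert (b u) (neighbours G (b u))" for v
    proof (rule ccontr)
      assume "\<not> ?thesis"
      then obtain u' where u': "u' \<in> U" "v = w u'" "u' \<notin> set (take k us)"
        using v(1) by (auto simp: B_def)
      then have "r (b u) < r u'" using late b(2)[OF uU] by (metis le_trans not_le)
      moreover have "b u \<in> insert (w u') (neighbours G (w u'))"
        using v(2) u'(2) N(2) by auto
      ultimately show False using w(2)[OF u'(1), of "b u"] by fastforce
    qed
    have bV: "b u \<in> pverts G" using b(1)[OF uU] N(1) by blast
    have "hop_step G (B \<union> w ` set (take k us), b ` set (take k us))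
      (insert (w u) (B \<union> w ` set (take k us)), insert (b u) (b ` set (take k us)))"
    proof (rule hop_step.force)
      show "b u \<in> B \<union> w ` set (take k us)" by (rule blue) (use bV in auto)
      show "b u \<notin> b ` set (take k us)"
        using unew uU done_U inj by (auto dest: inj_onD)
      show "neighbours G (b u) \<subseteq> B \<union> w ` set (take k us)" using blue N(1) by blast
      show "w u \<in> pverts G" using wV uU .
      show "w u \<notin> B \<union> w ` set (take k us)"
        using unew uU done_U inj_w by (auto simp: B_def dest: inj_onD)
      \<comment> \<open>As \<open>b u\<close> is ranked before \<open>u\<close>, it lies outside the
        closed neighbourhood of \<open>w u\<close>, in which \<open>u\<close> comes first. So the
        walk through \<open>u\<close> shows that the distance is exactly 2.\<close>
      have "b u \<notin> insert (w u) (neighbours G (w u))"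
        using w(2)[OF uU, of "b u"] b(2)[OF uU] by fastforce
      then have "w u \<noteq> b u" "w u \<notin> neighbours G (b u)" using N(2) by auto
      then show "graph_dist G (b u) (w u) = 2"
        using graph_dist_eq_2_iff[OF G bV] b(1)[OF uU] w(1)[OF uU] N(2) by blast
    qed
    with Suc take show ?case by (auto intro: rtranclp.rtrancl_into_rtrancl)
  qed auto
  from this[of "length us"] have "(hop_step G)\<^sup>*\<^sup>* (B, {}) (B \<union> w ` U, b ` U)"
    using us by simp
  moreover have "B \<union> w ` U = pverts G" using wV by (auto simp: B_def)
  ultimately have "hop_feasible G B" by (auto simp: hop_feasible_def B_def)
  then have "hopping_number G \<le> card B" by (rule hopping_number_le)
  moreover have "card B = card (pverts G) - card U"
    unfolding B_def using wV finU by (subst card_Diff_subset) (auto simp: card_image[OF inj_w])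
  moreover have "card U \<le> card (pverts G)" using U fin by (rule card_mono[rotated])
  ultimately show ?thesis by simp
qed

section \<open>Cutting the paths into pieces\<close>

lemma walk_to_path:
  assumes "successively (\<lambda>x y. (x, y) \<in> E) ws" "ws \<noteq> []"
  shows "\<exists>ps. is_path E ps \<and> ps \<noteq> [] \<and> hd ps = hd ws \<and> last ps = last ws \<and>
    set ps \<subseteq> set ws \<and> length ps \<le> length ws"
  using assms
proof (induction ws)
  case (Cons x ws)
  show ?case
  proof (cases "ws = []")
    case True
    then show ?thesis by (intro exI[of _ "[x]"]) (auto simp: is_path_def)
  next
    case False
    with Cons obtain ps where ps: "is_path E ps" "ps \<noteq> []" "hd ps = hd ws" "last ps = last ws"
      "set ps \<subseteq> set ws" "length ps \<le> length ws" by (auto simp: successively_Cons)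
    show ?thesis
    proof (cases "x \<in> set ps")
      case True
      then obtain as bs where "ps = as @ x # bs" by (meson split_list)
      then show ?thesis using ps False
        by (intro exI[of _ "x # bs"]) (auto simp: is_path_def successively_append_iff)
    next
      case nx: False
      then have "is_path E (x # ps)"
        using ps Cons.prems False by (auto simp: is_path_def successively_Cons)
      then show ?thesis using ps False by (intro exI[of _ "x # ps"]) auto
    qed
  qed
qed simp

text \<open>Shortening the walk to a path preserves its ends and keeps it off u; distinct ends leave
  at least two vertices, so u closes the path to a cycle.\<close>

lemma short_cycle_through_neighbours:
  assumes "sym E" "(u, hd ws) \<in> E" "(u, last ws) \<in> E" "hd ws \<noteq> last ws"
    and ws: "successively (\<lambda>x y. (x, y) \<in> E) ws" "ws \<noteq> []" "u \<notin> set ws" "Suc (length ws) \<le> k"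
  shows "u \<in> short_cycle_verts E k"
proof -
  obtain ps where ps: "is_path E ps" "ps \<noteq> []" "hd ps = hd ws" "last ps = last ws"
    "set ps \<subseteq> set ws" "length ps \<le> length ws" using walk_to_path[OF ws(1,2)] by blast
  have "2 \<le> length ps"
    using ps assms(4) by (cases ps; cases "tl ps") auto
  then have "is_cycle E (u # ps)"
    using ps assms symD[OF assms(1)] by (auto simp: is_cycle_def is_path_def successively_Cons)
  then show ?thesis
    using ps ws by (auto simp: short_cycle_verts_def intro!: exI[of _ "u # ps"])
qed

text \<open>\<open>\<pi> v\<close> names the piece containing v and \<open>\<iota> v\<close> is the
  position of v on it. By \<open>idx_down\<close> the positions used on a piece form an initial
  segment of the naturals, so each piece is a path with at most L vertices. Names rather than lists
  are convenient because the random labels are attached to \<open>\<pi> v\<close>.\<close>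

locale path_pieces =
  fixes V :: "'a set" and E :: "'a rel" and d L :: nat and \<pi> :: "'a \<Rightarrow> 'p" and \<iota> :: "'a \<Rightarrow> nat"
  assumes graph: "simple_graph V E"
    and regular: "\<And>v. v \<in> V \<Longrightarrow> card (E `` {v}) = d"
    and idx_less: "\<And>v. v \<in> V \<Longrightarrow> \<iota> v < L"
    and idx_inj: "\<And>u v. u \<in> V \<Longrightarrow> v \<in> V \<Longrightarrow> \<pi> u = \<pi> v \<Longrightarrow> \<iota> u = \<iota> v \<Longrightarrow> u = v"
    and idx_adj: "\<And>u v. u \<in> V \<Longrightarrow> v \<in> V \<Longrightarrow> \<pi> u = \<pi> v \<Longrightarrow> \<iota> v = Suc (\<iota> u) \<Longrightarrow> (u, v) \<in> E"
    and idx_down: "\<And>v i. v \<in> V \<Longrightarrow> i \<le> \<iota> v \<Longrightarrow> \<exists>u\<in>V. \<pi> u = \<pi> v \<and> \<iota> u = i"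

lemma path_cover_pieces:
  assumes G: "simple_graph V E" "\<And>v. v \<in> V \<Longrightarrow> card (E `` {v}) = d"
    and P: "path_cover V E P" and L: "0 < L"
  obtains \<pi> :: "'a \<Rightarrow> 'a list \<times> nat" and \<iota> :: "'a \<Rightarrow> nat" where "path_pieces V E d L \<pi> \<iota>"
    "real (card (\<pi> ` V)) \<le> real (card P) + real (card V) / real L"
proof -
  have "\<exists>p i. p \<in> P \<and> i < length p \<and> v = p ! i" if vV: "v \<in> V" for v
  proof -
    obtain q where "q \<in> P" "v \<in> set q" using P vV by (auto simp: path_cover_def)
    then show ?thesis unfolding in_set_conv_nth by blast
  qed
  then obtain p j where pj: "p v \<in> P" "j v < length (p v)" "v = p v ! j v" if "v \<in> V" for v
    by metis
  have disj: "p = q" if "p \<in> P" "q \<in> P" "x \<in> set p" "x \<in> set q" for p q x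
    using P that unfolding path_cover_def by blast
  have dist: "distinct q" if "q \<in> P" for q using P that by (auto simp: path_cover_def is_path_def)
  have eqI: "p x = q" "j x = i" "x \<in> V" if q: "q \<in> P" "i < length q" "x = q ! i" for x q i
  proof -
    show xV: "x \<in> V" using P q by (auto simp: path_cover_def)
    have "x \<in> set (p x)" using pj[OF xV] nth_mem by metis
    then show pq: "p x = q" using disj[of "p x" q x] pj[OF xV] q nth_mem by metis
    show "j x = i" using pj[OF xV] q pq dist[OF q(1)] nth_eq_iff_index_eq by metis
  qed
  \<comment> \<open>Each path is cut after every L vertices: the quotient names the piece, the
    remainder is the position. The last, possibly incomplete, piece of each path accounts for the
    term \<open>card P\<close>.\<close>
  define \<pi> where "\<pi> v = (p v, j v div L)" for v
  define \<iota> where "\<iota> v = j v mod L" for v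
  have j_eq: "j v = snd (\<pi> v) * L + \<iota> v" for v by (simp add: \<pi>_def \<iota>_def)
  have finP: "finite P" using P by (simp add: path_cover_def)
  have "path_pieces V E d L \<pi> \<iota>"
  proof
    show "\<iota> v < L" for v using L by (simp add: \<iota>_def)
    show "u = v" if "u \<in> V" "v \<in> V" "\<pi> u = \<pi> v" "\<iota> u = \<iota> v" for u v
    proof -
      have "p u = p v" using that(3) by (simp add: \<pi>_def)
      moreover have "j u = j v" using that(3,4) j_eq by metis
      ultimately show ?thesis using pj[OF that(1)] pj[OF that(2)] by simp
    qed
    show "(u, v) \<in> E" if "u \<in> V" "v \<in> V" "\<pi> u = \<pi> v" "\<iota> v = Suc (\<iota> u)" for u v
    proof -
      have "p u = p v" using that(3) by (simp add: \<pi>_def)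
      moreover have "j v = Suc (j u)" using that(3,4) j_eq add_Suc_right by metis
      moreover have "is_path E (p u)" using P pj[OF that(1)] by (auto simp: path_cover_def)
      ultimately show ?thesis using pj[OF that(1)] pj[OF that(2)]
        unfolding is_path_def successively_conv_nth by metis
    qed
    show "\<exists>u\<in>V. \<pi> u = \<pi> v \<and> \<iota> u = i" if "v \<in> V" "i \<le> \<iota> v" for v i
    proof -
      define k where "k = (j v div L) * L + i"
      have iL: "i < L" using that L by (auto simp: \<iota>_def intro: le_less_trans)
      have "j v = (j v div L) * L + \<iota> v" by (simp add: \<iota>_def)
      then have "k \<le> j v" using that(2) unfolding k_def by linarith
      then have k: "k < length (p v)" using pj[OF that(1)] by simp
      have "p (p v ! k) = p v" "j (p v ! k) = k" "p v ! k \<in> V"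
        using eqI[OF _ k refl] pj[OF that(1)] by auto
      moreover have "k div L = j v div L" "k mod L = i" using iL by (auto simp: k_def)
      ultimately show ?thesis by (intro bexI[of _ "p v ! k"]) (auto simp: \<pi>_def \<iota>_def)
    qed
  qed (fact G)+
  moreover have "real (card (\<pi> ` V)) \<le> real (card P) + real (card V) / real L"
  proof -
    have "\<pi> ` V \<subseteq> (SIGMA q:P. {..length q div L})"
    proof (rule image_subsetI)
      fix v assume v: "v \<in> V"
      then show "\<pi> v \<in> (SIGMA q:P. {..length q div L})"
        using pj(1)[OF v] div_le_mono[OF less_imp_le[OF pj(2)[OF v]], of L]
        unfolding \<pi>_def by blast
    qed
    then have "card (\<pi> ` V) \<le> card (SIGMA q:P. {..length q div L})"
      using finP by (intro card_mono) auto
    also have "\<dots> = (\<Sum>q\<in>P. length q div L + 1)" using finP by (simp add: card_SigmaI)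
    finally have "real (card (\<pi> ` V)) \<le> real (\<Sum>q\<in>P. length q div L + 1)"
      by (simp only: of_nat_le_iff)
    also have "\<dots> = (\<Sum>q\<in>P. real (length q div L) + 1)" by (simp add: add.commute)
    also have "\<dots> \<le> (\<Sum>q\<in>P. real (length q) / real L + 1)"
      by (intro sum_mono add_right_mono) (rule of_nat_div_le_of_nat)
    also have "\<dots> = real (card P) + real (\<Sum>q\<in>P. length q) / real L"
      by (simp add: sum.distrib sum_divide_distrib)
    also have "(\<Sum>q\<in>P. length q) = (\<Sum>q\<in>P. card (set q))"
      using dist by (intro sum.cong) (auto simp: distinct_card)
    also have "\<dots> = card (\<Union>q\<in>P. set q)"
      using P by (subst card_UN_disjoint) (auto simp: path_cover_def)
    also have "(\<Union>q\<in>P. set q) = V" using P by (auto simp: path_cover_def)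
    finally show ?thesis .
  qed
  ultimately show ?thesis by (rule that)
qed

context path_pieces
begin

lemma finite_V: "finite V" and E_sub: "E \<subseteq> V \<times> V" and sym_E: "sym E" and irrefl_E: "irrefl E"
  using graph by (auto simp: simple_graph_def)

lemma finite_Image: "finite (E `` S)"
  using finite_subset[OF _ finite_V, of "E `` S"] E_sub by blast

definition ends :: "'a set" where
  "ends = {v \<in> V. \<iota> v = 0 \<or> \<not> (\<exists>x\<in>V. \<pi> x = \<pi> v \<and> \<iota> x = Suc (\<iota> v))}"

text \<open>Neighbours w of u must not be ends either, since w has to share its piece with two of
  its own neighbours. The bound L + 3 is for cycles consisting of u, two neighbours of u, and a
  segment of a piece with at most L vertices.\<close>

definition good :: "'a set" where
  "good = {u \<in> V. u \<notin> short_cycle_verts E (L + 3) \<and> insert u (E `` {u}) \<inter> ends = {}}"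

lemma card_ends: "card ends \<le> 2 * card (\<pi> ` V)"
proof -
  define A where "A = {v \<in> V. \<iota> v = 0}"
  define B where "B = {v \<in> V. \<not> (\<exists>x\<in>V. \<pi> x = \<pi> v \<and> \<iota> x = Suc (\<iota> v))}"
  have "inj_on \<pi> A" by (auto simp: inj_on_def A_def intro: idx_inj)
  then have A: "card A \<le> card (\<pi> ` V)"
    by (rule card_inj_on_le) (use finite_V in \<open>auto simp: A_def\<close>)
  have lt: False if "u \<in> B" "v \<in> B" "\<pi> u = \<pi> v" "\<iota> u < \<iota> v" for u v
    using that idx_down[of v "Suc (\<iota> u)"] by (auto simp: B_def)
  have "inj_on \<pi> B"
  proof (rule inj_onI)
    fix u v assume uv: "u \<in> B" "v \<in> B" "\<pi> u = \<pi> v"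
    then have "\<iota> u = \<iota> v" using lt[of u v] lt[of v u] by (metis nat_neq_iff)
    then show "u = v" using uv idx_inj by (auto simp: B_def)
  qed
  then have B: "card B \<le> card (\<pi> ` V)"
    by (rule card_inj_on_le) (use finite_V in \<open>auto simp: B_def\<close>)
  have "ends = A \<union> B" by (auto simp: ends_def A_def B_def)
  then show ?thesis using A B card_Un_le[of A B] by simp
qed

lemma card_not_good:
  "card (V - good) \<le> card (short_cycle_verts E (L + 3)) + (d + 1) * (2 * card (\<pi> ` V))"
proof -
  have fin: "finite (short_cycle_verts E (L + 3))" "finite ends"
    using finite_subset[OF short_cycle_verts_subset[OF E_sub] finite_V] finite_V
    by (auto simp: ends_def)
  have "V - good \<subseteq> short_cycle_verts E (L + 3) \<union> (\<Union>x\<in>ends. insert x (E `` {x}))"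
    using sym_E by (auto simp: good_def dest: symD)
  then have "card (V - good) \<le> card (short_cycle_verts E (L + 3) \<union> (\<Union>x\<in>ends. insert x (E `` {x})))"
    using fin finite_Image by (intro card_mono) auto
  also have "\<dots> \<le> card (short_cycle_verts E (L + 3)) + card (\<Union>x\<in>ends. insert x (E `` {x}))"
    by (rule card_Un_le)
  also have "card (\<Union>x\<in>ends. insert x (E `` {x})) \<le> (\<Sum>x\<in>ends. card (insert x (E `` {x})))"
    using fin by (intro card_UN_le)
  also have "\<dots> \<le> (\<Sum>x\<in>ends. d + 1)"
    using regular finite_Image by (intro sum_mono) (auto simp: card_insert_if ends_def)
  also have "\<dots> = (d + 1) * card ends" by simp
  also have "\<dots> \<le> (d + 1) * (2 * card (\<pi> ` V))" using card_ends by (rule mult_le_mono2)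
  finally show ?thesis by simp
qed

lemma piece_path_up:
  assumes "x \<in> V" "y \<in> V" "\<pi> x = \<pi> y" "\<iota> x \<le> \<iota> y"
  shows "\<exists>zs. successively (\<lambda>a b. (a, b) \<in> E) zs \<and> zs \<noteq> [] \<and> hd zs = x \<and> last zs = y \<and>
    length zs = Suc (\<iota> y - \<iota> x) \<and> (\<forall>z\<in>set zs. z \<in> V \<and> \<pi> z = \<pi> x \<and> \<iota> x \<le> \<iota> z \<and> \<iota> z \<le> \<iota> y)"
  using assms
proof (induction "\<iota> y - \<iota> x" arbitrary: y)
  case 0
  then have "x = y" by (intro idx_inj) auto
  then show ?case using 0 by (intro exI[of _ "[x]"]) auto
next
  case (Suc n)
  obtain y' where y': "y' \<in> V" "\<pi> y' = \<pi> y" "\<iota> y' = \<iota> y - 1"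
    using idx_down[of y "\<iota> y - 1"] Suc.prems by auto
  then have "n = \<iota> y' - \<iota> x" "\<iota> x \<le> \<iota> y'" "\<pi> x = \<pi> y'" using Suc by auto
  with Suc.hyps(1)[of y'] Suc.prems y' obtain zs where zs: "successively (\<lambda>a b. (a, b) \<in> E) zs"
    "zs \<noteq> []" "hd zs = x" "last zs = y'" "length zs = Suc (\<iota> y' - \<iota> x)"
    "\<forall>z\<in>set zs. z \<in> V \<and> \<pi> z = \<pi> x \<and> \<iota> x \<le> \<iota> z \<and> \<iota> z \<le> \<iota> y'" by blast
  have "(y', y) \<in> E" using idx_adj[of y' y] y' Suc by auto
  then show ?case using zs y' Suc
    by (intro exI[of _ "zs @ [y]"]) (auto simp: successively_append_iff)
qed

text \<open>The bounds on the positions along the segment serve to keep it off a vertex u of the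
  same piece whose position lies outside the range.\<close>

lemma piece_path:
  assumes "x \<in> V" "y \<in> V" "\<pi> x = \<pi> y"
  shows "\<exists>zs. successively (\<lambda>a b. (a, b) \<in> E) zs \<and> zs \<noteq> [] \<and> hd zs = x \<and> last zs = y \<and>
    length zs \<le> L \<and>
    (\<forall>z\<in>set zs. \<pi> z = \<pi> x \<and> min (\<iota> x) (\<iota> y) \<le> \<iota> z \<and> \<iota> z \<le> max (\<iota> x) (\<iota> y))"
proof (cases "\<iota> x \<le> \<iota> y")
  case True
  then obtain zs where "successively (\<lambda>a b. (a, b) \<in> E) zs" "zs \<noteq> []" "hd zs = x" "last zs = y"
    "length zs = Suc (\<iota> y - \<iota> x)" "\<forall>z\<in>set zs. z \<in> V \<and> \<pi> z = \<pi> x \<and> \<iota> x \<le> \<iota> z \<and> \<iota> z \<le> \<iota> y"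
    using piece_path_up[of x y] assms by blast
  then show ?thesis using True idx_less[OF assms(2)] by (intro exI[of _ zs]) auto
next
  case False
  then obtain zs where "successively (\<lambda>a b. (a, b) \<in> E) zs" "zs \<noteq> []" "hd zs = y" "last zs = x"
    "length zs = Suc (\<iota> x - \<iota> y)" "\<forall>z\<in>set zs. z \<in> V \<and> \<pi> z = \<pi> y \<and> \<iota> y \<le> \<iota> z \<and> \<iota> z \<le> \<iota> x"
    using piece_path_up[of y x] assms by auto
  moreover have "successively (\<lambda>a b. (b, a) \<in> E) zs"
    using calculation(1) sym_E by (auto elim: successively_mono dest: symD)
  ultimately show ?thesis using False idx_less[OF assms(1)] assms
    by (intro exI[of _ "rev zs"]) (auto simp: hd_rev last_rev)
qed

text \<open>
  If all pieces meeting \<open>w\<close> or its neighbours, other than the piece of \<open>u\<close>, come later than the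
  piece of \<open>u\<close>, then \<open>u\<close> is the first vertex of the closed neighbourhood of \<open>w\<close>. For distinct \<open>w\<close>
  these sets of pieces are disjoint, since \<open>u\<close> lies on no short cycle.
\<close>
lemma good_vertex:
  assumes u: "u \<in> good" and d: "3 \<le> d"
  obtains b where "b \<in> E `` {u}" "\<pi> b = \<pi> u" "\<iota> u = Suc (\<iota> b)"
    "\<And>w. w \<in> E `` {u} - {b} \<Longrightarrow> card (\<pi> ` insert w (E `` {w}) - {\<pi> u}) \<le> d - 2"
    "\<And>w w'. w \<in> E `` {u} - {b} \<Longrightarrow> w' \<in> E `` {u} - {b} \<Longrightarrow> w \<noteq> w' \<Longrightarrow>
      (\<pi> ` insert w (E `` {w}) - {\<pi> u}) \<inter> (\<pi> ` insert w' (E `` {w'}) - {\<pi> u}) = {}"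
    "\<And>w x. w \<in> E `` {u} - {b} \<Longrightarrow> x \<in> insert w (E `` {w}) \<Longrightarrow> x \<noteq> u \<Longrightarrow> \<pi> x = \<pi> u \<Longrightarrow> \<iota> u < \<iota> x"
proof -
  have no_end: "w \<notin> ends" if "w \<in> insert u (E `` {u})" for w
    using u that by (auto simp: good_def)
  have uV: "u \<in> V" and no_cycle: "u \<notin> short_cycle_verts E (L + 3)" using u by (auto simp: good_def)
  have pred: "\<exists>b\<in>V. \<pi> b = \<pi> v \<and> \<iota> v = Suc (\<iota> b) \<and> (v, b) \<in> E"
    and succ: "\<exists>s\<in>V. \<pi> s = \<pi> v \<and> \<iota> s = Suc (\<iota> v) \<and> (v, s) \<in> E"
    if v: "v \<in> insert u (E `` {u})" for v
  proof -
    have vV: "v \<in> V" using v uV E_sub by auto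
    have "\<iota> v \<noteq> 0" and ex: "\<exists>x\<in>V. \<pi> x = \<pi> v \<and> \<iota> x = Suc (\<iota> v)"
      using no_end[OF v] vV by (auto simp: ends_def)
    moreover obtain b where b: "b \<in> V" "\<pi> b = \<pi> v" "\<iota> b = \<iota> v - 1"
      using idx_down[OF vV, of "\<iota> v - 1"] by auto
    ultimately have "\<iota> v = Suc (\<iota> b)" by simp
    then have "(v, b) \<in> E" using idx_adj[of b v] b vV symD[OF sym_E] by auto
    then show "\<exists>b\<in>V. \<pi> b = \<pi> v \<and> \<iota> v = Suc (\<iota> b) \<and> (v, b) \<in> E"
      using b \<open>\<iota> v = Suc (\<iota> b)\<close> by blast
    show "\<exists>s\<in>V. \<pi> s = \<pi> v \<and> \<iota> s = Suc (\<iota> v) \<and> (v, s) \<in> E"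
      using ex idx_adj[OF vV] by metis
  qed
  obtain b where b: "b \<in> V" "\<pi> b = \<pi> u" "\<iota> u = Suc (\<iota> b)" "(u, b) \<in> E" using pred[of u] by auto
  obtain s where s: "s \<in> V" "\<pi> s = \<pi> u" "\<iota> s = Suc (\<iota> u)" "(u, s) \<in> E" using succ[of u] by auto
  have cycleI: False
    if "(u, hd ws) \<in> E" "(u, last ws) \<in> E" "hd ws \<noteq> last ws" "successively (\<lambda>x y. (x, y) \<in> E) ws"
      "ws \<noteq> []" "u \<notin> set ws" "length ws \<le> L + 2" for ws
    using short_cycle_through_neighbours[OF sym_E that(1-6), of "L + 3"] that(7) no_cycle by auto
  have nbr: "w \<in> V" "w \<noteq> u" "(u, w) \<in> E" if "w \<in> E `` {u}" for w
    using that E_sub irrefl_E by (auto dest: irreflD)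
  have ext: "\<exists>ws. successively (\<lambda>x y. (x, y) \<in> E) ws \<and> ws \<noteq> [] \<and> hd ws = w \<and> last ws = last zs \<and>
      length ws \<le> Suc (length zs) \<and> set ws \<subseteq> insert w (set zs)"
    if "successively (\<lambda>x y. (x, y) \<in> E) zs" "zs \<noteq> []" "hd zs \<in> insert w (E `` {w})" for w zs
  proof (cases "hd zs = w")
    case True
    then show ?thesis using that by (intro exI[of _ zs]) auto
  next
    case False
    then show ?thesis using that by (intro exI[of _ "w # zs"]) (auto simp: successively_Cons)
  qed
  \<comment> \<open>Let x lie on the piece of u. The segment from x to the neighbour of u on that
    side (b below, s above) avoids u and, prolonged by w, closes a short cycle through u, unless w
    is that very neighbour. As w \<noteq> b, only w = s with x above u remains.\<close>
  have same_piece: "w = s \<and> \<iota> u < \<iota> x"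
    if w: "w \<in> E `` {u} - {b}" and x: "x \<in> insert w (E `` {w})" "x \<noteq> u" "\<pi> x = \<pi> u" for w x
  proof (rule ccontr)
    assume neg: "\<not> ?thesis"
    have xV: "x \<in> V" using x w nbr E_sub by auto
    have neq: "\<iota> x \<noteq> \<iota> u" using idx_inj[OF xV uV] x by auto
    define y where "y = (if \<iota> x < \<iota> u then b else s)"
    have y: "y \<in> V" "\<pi> x = \<pi> y" "(u, y) \<in> E" "w \<noteq> y" using b s neg neq w x by (auto simp: y_def)
    obtain zs where zs: "successively (\<lambda>a b. (a, b) \<in> E) zs" "zs \<noteq> []" "hd zs = x" "last zs = y"
      "length zs \<le> L" "\<forall>z\<in>set zs. min (\<iota> x) (\<iota> y) \<le> \<iota> z \<and> \<iota> z \<le> max (\<iota> x) (\<iota> y)"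
      using piece_path[OF xV y(1,2)] by blast
    have "\<iota> u \<notin> {min (\<iota> x) (\<iota> y)..max (\<iota> x) (\<iota> y)}" using neq b s by (auto simp: y_def)
    then have "u \<notin> set zs" using zs(6) by auto
    moreover obtain ws where "successively (\<lambda>x y. (x, y) \<in> E) ws" "ws \<noteq> []" "hd ws = w"
      "last ws = y" "length ws \<le> Suc (length zs)" "set ws \<subseteq> insert w (set zs)"
      using ext[OF zs(1,2), of w] zs x by auto
    ultimately show False using cycleI[of ws] zs(5) y nbr[of w] w by auto
  qed
  \<comment> \<open>A common piece other than that of u yields a walk from w' to w through a segment
    of it, with at most L + 2 vertices and avoiding u.\<close>
  have disjoint: False
    if w: "w \<in> E `` {u} - {b}" "w' \<in> E `` {u} - {b}" "w \<noteq> w'"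
      and x: "x \<in> insert w (E `` {w})" "x' \<in> insert w' (E `` {w'})" "\<pi> x = \<pi> x'" "\<pi> x \<noteq> \<pi> u"
    for w w' x x'
  proof -
    have xV: "x \<in> V" "x' \<in> V" using x w nbr E_sub by auto
    obtain zs where zs: "successively (\<lambda>a b. (a, b) \<in> E) zs" "zs \<noteq> []" "hd zs = x" "last zs = x'"
      "length zs \<le> L" "\<forall>z\<in>set zs. \<pi> z = \<pi> x" using piece_path[OF xV x(3)] by blast
    obtain ws where ws: "successively (\<lambda>x y. (x, y) \<in> E) ws" "ws \<noteq> []" "hd ws = w"
      "last ws = x'" "length ws \<le> Suc (length zs)" "set ws \<subseteq> insert w (set zs)"
      using ext[OF zs(1,2), of w] zs x by auto
    have "successively (\<lambda>x y. (x, y) \<in> E) (rev ws)"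
      using ws(1) sym_E by (auto elim: successively_mono dest: symD)
    then obtain vs where vs: "successively (\<lambda>x y. (x, y) \<in> E) vs" "vs \<noteq> []" "hd vs = w'"
      "last vs = w" "length vs \<le> Suc (length ws)" "set vs \<subseteq> insert w' (set ws)"
      using ext[of "rev ws" w'] ws x by (auto simp: hd_rev last_rev)
    have "u \<notin> set zs" using zs(6) x(4) by auto
    then have "u \<notin> set vs" using vs(6) ws(6) nbr[of w] nbr[of w'] w by auto
    then show False using cycleI[of vs] vs ws(5) zs(5) w by auto
  qed
  \<comment> \<open>The exponent d - 2 arises here. If w = s, then u and the successor of w are two
    neighbours of w on the piece of u, and at most d - 2 others contribute. Otherwise u is
    discarded, and w, its predecessor and its successor share one piece, represented by the
    successor.\<close>
  have small: "card (\<pi> ` insert w (E `` {w}) - {\<pi> u}) \<le> d - 2" if w: "w \<in> E `` {u} - {b}" for w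
  proof -
    obtain wp ws where wp: "wp \<in> V" "\<pi> wp = \<pi> w" "\<iota> w = Suc (\<iota> wp)" "(w, wp) \<in> E"
      and ws: "ws \<in> V" "\<pi> ws = \<pi> w" "\<iota> ws = Suc (\<iota> w)" "(w, ws) \<in> E"
      using pred[of w] succ[of w] w by auto
    have wu: "u \<in> E `` {w}" using w symD[OF sym_E] by auto
    have deg: "card (E `` {w}) = d" using regular nbr w by auto
    have img: "card (\<pi> ` A) \<le> d - 2" if "A = E `` {w} - {u, x}" "x \<in> E `` {w}" "x \<noteq> u" for A x
    proof -
      have "card A = d - 2" using that wu deg finite_Image by (simp add: card_Diff_subset)
      then show ?thesis using card_image_le[of A \<pi>] that finite_Image by auto
    qed
    show ?thesis
    proof (cases "w = s")
      case True
      have "ws \<noteq> u" using ws s True by auto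
      have "\<pi> ` insert w (E `` {w}) - {\<pi> u} \<subseteq> \<pi> ` (E `` {w} - {u, ws})"
        using True s ws by auto
      then have "card (\<pi> ` insert w (E `` {w}) - {\<pi> u}) \<le> card (\<pi> ` (E `` {w} - {u, ws}))"
        using finite_Image by (intro card_mono) auto
      then show ?thesis using img[OF refl, of ws] ws \<open>ws \<noteq> u\<close> by simp
    next
      case False
      then have piece: "\<pi> w \<noteq> \<pi> u" using same_piece[OF w, of w] nbr w by auto
      then have "wp \<noteq> u" "ws \<noteq> u" using wp ws by auto
      have "ws \<noteq> wp" using ws wp by auto
      have "\<pi> ` insert w (E `` {w}) - {\<pi> u} \<subseteq> \<pi> ` (E `` {w} - {u, wp})"
      proof
        fix q assume "q \<in> \<pi> ` insert w (E `` {w}) - {\<pi> u}"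
        then obtain x where x: "x \<in> insert w (E `` {w})" "q = \<pi> x" "\<pi> x \<noteq> \<pi> u" by auto
        show "q \<in> \<pi> ` (E `` {w} - {u, wp})"
        proof (cases "x = w \<or> x = wp")
          case True
          then have "q = \<pi> ws" using x ws wp by auto
          moreover have "ws \<in> E `` {w} - {u, wp}"
            using ws \<open>ws \<noteq> u\<close> \<open>ws \<noteq> wp\<close> by auto
          ultimately show ?thesis by (rule image_eqI)
        next
          case False
          then show ?thesis using x by auto
        qed
      qed
      then have "card (\<pi> ` insert w (E `` {w}) - {\<pi> u}) \<le> card (\<pi> ` (E `` {w} - {u, wp}))"
        using finite_Image by (intro card_mono) auto
      then show ?thesis using img[OF refl, of wp] wp \<open>wp \<noteq> u\<close> by simp
    qed
  qed
  show ?thesis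
  proof (rule that[of b])
    show "b \<in> E `` {u}" using b by auto
    show "\<pi> b = \<pi> u" "\<iota> u = Suc (\<iota> b)" using b by auto
    show "card (\<pi> ` insert w (E `` {w}) - {\<pi> u}) \<le> d - 2" if "w \<in> E `` {u} - {b}" for w
      by (rule small[OF that])
    show "(\<pi> ` insert w (E `` {w}) - {\<pi> u}) \<inter> (\<pi> ` insert w' (E `` {w'}) - {\<pi> u}) = {}"
      if "w \<in> E `` {u} - {b}" "w' \<in> E `` {u} - {b}" "w \<noteq> w'" for w w'
    proof (rule ccontr)
      assume "\<not> ?thesis"
      then obtain q where q: "q \<in> \<pi> ` insert w (E `` {w})" "q \<in> \<pi> ` insert w' (E `` {w'})" "q \<noteq> \<pi> u"
        by blast
      then obtain x x' where "x \<in> insert w (E `` {w})" "q = \<pi> x" "x' \<in> insert w' (E `` {w'})" "q = \<pi> x'"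
        by blast
      then show False using disjoint[OF that, of x x'] q(3) by simp
    qed
    show "\<iota> u < \<iota> x" if "w \<in> E `` {u} - {b}" "x \<in> insert w (E `` {w})" "x \<noteq> u" "\<pi> x = \<pi> u" for w x
      using same_piece that by blast
  qed
qed

end

section \<open>Random labels\<close>

text \<open>This is the Beta integral B(1/a, m + 1) / a. The function s (1 - s^a)^(m+1) vanishes at
  0 and 1; integrating its derivative gives the recursion (k + 1) I(m+1) = k I(m) with k = (m + 1)
  a.\<close>

lemma integral_one_minus_power:
  fixes a m :: nat
  assumes a: "0 < a"
  shows "((\<lambda>s::real. (1 - s ^ a) ^ m) has_integral
    (\<Prod>i = 1..m. real i * real a / (real i * real a + 1))) {0..1}"
proof (induction m)
  case 0
  have "((\<lambda>s::real. 1 :: real) has_integral 1) {0..1}"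
    using has_integral_const_real[of "1::real" 0 1] by simp
  then show ?case by simp
next
  case (Suc m)
  define I where "I = (\<Prod>i = 1..m. real i * real a / (real i * real a + 1))"
  define k where "k = real (Suc m) * real a"
  have k: "k > 0" using a by (simp add: k_def)
  have deriv: "((\<lambda>s::real. s * (1 - s ^ a) ^ Suc m) has_vector_derivative
      ((k + 1) * (1 - s ^ a) ^ Suc m - k * (1 - s ^ a) ^ m)) (at s within {0..1})" for s :: real
  proof -
    have "((\<lambda>s. 1 - s ^ a) has_real_derivative - (real a * s ^ (a - 1))) (at s within {0..1})"
      by (auto intro!: derivative_eq_intros)
    from DERIV_mult[OF DERIV_ident DERIV_power_Suc[OF this, of m]]
    have "((\<lambda>s. s * (1 - s ^ a) ^ Suc m) has_real_derivative
      ((1 - s ^ a) ^ Suc m + s * (real (Suc m) * (1 - s ^ a) ^ m * (- (real a * s ^ (a - 1))))))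
      (at s within {0..1})"
      by (simp add: algebra_simps)
    moreover have "s * s ^ (a - 1) = s ^ a" using a by (simp add: power_eq_if)
    then have "s * (real (Suc m) * (1 - s ^ a) ^ m * (- (real a * s ^ (a - 1))))
      = - k * (1 - s ^ a) ^ m * s ^ a" by (simp add: k_def)
    moreover have "(1 - s ^ a) ^ Suc m + (- k * (1 - s ^ a) ^ m * s ^ a)
      = (k + 1) * (1 - s ^ a) ^ Suc m - k * (1 - s ^ a) ^ m" by (simp add: algebra_simps)
    ultimately show ?thesis
      unfolding has_real_derivative_iff_has_vector_derivative[symmetric] by (simp only:)
  qed
  have "((\<lambda>s. (k + 1) * (1 - s ^ a) ^ Suc m - k * (1 - s ^ a) ^ m) has_integral
      (1 * (1 - 1 ^ a) ^ Suc m - 0 * (1 - 0 ^ a) ^ Suc m)) {0..1::real}"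
    by (intro fundamental_theorem_of_calculus deriv) auto
  then have "((\<lambda>s. (k + 1) * (1 - s ^ a) ^ Suc m - k * (1 - s ^ a) ^ m) has_integral 0) {0..1::real}"
    by simp
  moreover have "((\<lambda>s. k * (1 - s ^ a) ^ m) has_integral k * I) {0..1::real}"
    using Suc unfolding I_def by (rule has_integral_mult_right)
  ultimately have "((\<lambda>s. (k + 1) * (1 - s ^ a) ^ Suc m) has_integral 0 + k * I) {0..1::real}"
    by (auto dest: has_integral_add)
  then have "((\<lambda>s. (1 / (k + 1)) * ((k + 1) * (1 - s ^ a) ^ Suc m)) has_integral
      (1 / (k + 1)) * (0 + k * I)) {0..1::real}"
    by (rule has_integral_mult_right)
  moreover have "(1 / (k + 1)) * ((k + 1) * x) = x" for x using k by simp
  moreover have "(1 / (k + 1)) * (0 + k * I)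
      = (\<Prod>i = 1..Suc m. real i * real a / (real i * real a + 1))"
    by (simp add: I_def k_def mult.commute)
  ultimately show ?case by simp
qed

text \<open>The sum over right endpoints lies below the integral, and passing to left endpoints
  changes the sum only by \<open>f 0 - f 1\<close>.\<close>

lemma riemann_sum_antimono_le:
  fixes f :: "real \<Rightarrow> real"
  assumes I: "(f has_integral I) {0..1}" and N: "0 < N"
    and mono: "\<And>x y. 0 \<le> x \<Longrightarrow> x \<le> y \<Longrightarrow> y \<le> 1 \<Longrightarrow> f y \<le> f x"
  shows "(\<Sum>j<N. f (real j / real N)) / real N \<le> I + (f 0 - f 1) / real N"
proof -
  have int: "f integrable_on {x..y}" if "0 \<le> x" "y \<le> 1" for x y
    using I that by (auto intro: integrable_on_subinterval[of _ "{0..1}"])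
  have step: "(\<Sum>j<n. f (real (Suc j) / real N)) / real N \<le> integral {0..real n / real N} f"
    if "n \<le> N" for n
    using that
  proof (induction n)
    case (Suc n)
    define x y where "x = real n / real N" and "y = real (Suc n) / real N"
    have xy: "0 \<le> x" "x \<le> y" "y \<le> 1" "y - x = 1 / real N"
      using Suc.prems N by (auto simp: x_def y_def field_simps)
    have "f y / real N = integral {x..y} (\<lambda>_. f y)" using xy by simp
    also have "\<dots> \<le> integral {x..y} f"
      using xy by (intro integral_le int) (auto intro!: mono)
    finally have "f y / real N \<le> integral {x..y} f" .
    moreover have "integral {0..x} f + integral {x..y} f = integral {0..y} f"
      using xy by (intro Henstock_Kurzweil_Integration.integral_combine int) auto
    ultimately show ?case using Suc by (simp add: x_def y_def add_divide_distrib)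
  qed simp
  have "(\<Sum>j<N. f (real (Suc j) / real N)) = (\<Sum>j<N. f (real j / real N)) + f 1 - f 0"
    using sum.lessThan_Suc_shift[of "\<lambda>j. f (real j / real N)" N] N by simp
  with step[of N] have "((\<Sum>j<N. f (real j / real N)) + f 1 - f 0) / real N \<le> integral {0..1} f"
    using N by simp
  also have "integral {0..1} f = I" using I by (rule integral_unique)
  finally show ?thesis by (simp add: add_divide_distrib diff_divide_distrib)
qed

lemma riemann_sum_one_minus_power:
  fixes a m N :: nat
  assumes "0 < a" "0 < N"
  shows "(\<Sum>j<N. (1 - (real j / real N) ^ a) ^ m) / real N
    \<le> (\<Prod>i = 1..m. real i * real a / (real i * real a + 1)) + 1 / real N"
proof -
  have "(\<Sum>j<N. (1 - (real j / real N) ^ a) ^ m) / real N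
    \<le> (\<Prod>i = 1..m. real i * real a / (real i * real a + 1))
      + ((1 - 0 ^ a) ^ m - (1 - 1 ^ a) ^ m) / real N"
    by (rule riemann_sum_antimono_le[OF integral_one_minus_power[OF assms(1)] assms(2)])
      (auto intro!: power_mono simp: power_le_one)
  also have "((1 - 0 ^ a) ^ m - (1 - 1 ^ a) ^ m) / real N \<le> 1 / real N"
    using assms by (intro divide_right_mono) (auto simp: power_0_left)
  finally show ?thesis by simp
qed

text \<open>
  Expanding \<open>\<Prod>w. 1 - g w\<close>, with \<open>g w\<close> the indicator of the event for \<open>w\<close>, over the subsets of \<open>W\<close>
  reduces the independence of these events to the product measure.
\<close>
lemma prob_no_group_above:
  fixes T :: "'w \<Rightarrow> 'q set"
  assumes Q: "finite Q" "p \<in> Q" and W: "finite W" and N: "0 < N"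
    and T: "\<And>w. w \<in> W \<Longrightarrow> T w \<subseteq> Q - {p}" "\<And>w. w \<in> W \<Longrightarrow> card (T w) \<le> a"
    and disj: "\<And>w w'. w \<in> W \<Longrightarrow> w' \<in> W \<Longrightarrow> w \<noteq> w' \<Longrightarrow> T w \<inter> T w' = {}"
  shows "measure_pmf.prob (Pi_pmf Q 0 (\<lambda>_. pmf_of_set {..<N}))
      {l. \<forall>w\<in>W. \<not> (\<forall>q\<in>T w. l p < l q)}
    \<le> (\<Sum>j<N. (1 - (real j / real N) ^ a) ^ card W) / real N"
proof -
  define M where "M = Pi_pmf Q (0::nat) (\<lambda>_. pmf_of_set {..<N})"
  \<comment> \<open>The probability that a uniform label in \<open>{..<N}\<close> is strictly larger
    than j.\<close>
  define x where "x j = real (N - Suc j) / real N" for j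
  have x01: "0 \<le> x j" "x j \<le> 1" for j using N by (auto simp: x_def)
  have finT: "finite (T w)" if "w \<in> W" for w using T(1)[OF that] Q finite_subset by blast
  have fin_UT: "finite (\<Union>w\<in>X. T w)" if "X \<subseteq> W" for X
    using that finT W by (meson finite_UN_I finite_subset subsetD)
  have above: "measure_pmf.prob (pmf_of_set {..<N}) {y. j < y} = x j" for j
  proof -
    have "{..<N} \<inter> {y. j < y} = {Suc j..<N}" by auto
    then show ?thesis using N by (subst measure_pmf_of_set) (auto simp: x_def)
  qed
  have single: "measure_pmf.prob (pmf_of_set {..<N}) {j} = 1 / real N" if "j < N" for j
    using N that by (subst measure_pmf_of_set) auto
  have prod: "measure_pmf.prob M {l. l p = j \<and> (\<forall>q\<in>S. j < l q)} = (1 / real N) * x j ^ card S"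
    if j: "j < N" and S: "S \<subseteq> Q - {p}" for j S
  proof -
    define B where "B q = (if q = p then {j} else if q \<in> S then {y. j < y} else UNIV)" for q
    have "{l. l p = j \<and> (\<forall>q\<in>S. j < l q)} = Pi Q B"
      using S Q by (auto simp: B_def Pi_def)
    then have "measure_pmf.prob M {l. l p = j \<and> (\<forall>q\<in>S. j < l q)}
      = (\<Prod>q\<in>Q. measure_pmf.prob (pmf_of_set {..<N}) (B q))"
      unfolding M_def using Q by (simp add: measure_Pi_pmf_Pi)
    also have "\<dots> = measure_pmf.prob (pmf_of_set {..<N}) (B p) *
        (\<Prod>q\<in>Q - {p}. measure_pmf.prob (pmf_of_set {..<N}) (B q))"
      using Q by (simp add: prod.remove)
    also have "(\<Prod>q\<in>Q - {p}. measure_pmf.prob (pmf_of_set {..<N}) (B q))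
        = (\<Prod>q\<in>Q - {p}. if q \<in> S then x j else 1)"
      by (intro prod.cong) (auto simp: B_def above)
    also have "\<dots> = x j ^ card S"
      using Q S by (simp add: prod.If_cases Int_absorb1 flip: prod.inter_restrict)
    finally show ?thesis using j single by (simp add: B_def)
  qed
  \<comment> \<open>The events for different w are dependent through the label of p. Fixing its
    value j leaves conditions on disjoint sets of labels.\<close>
  define ind where "ind j l = (indicator {l. l p = j} l :: real)" for j :: nat and l :: "'q \<Rightarrow> nat"
  define g where "g j w l = (indicator {l. \<forall>q\<in>T w. j < l q} l :: real)"
    for j :: nat and w and l :: "'q \<Rightarrow> nat"
  have g_prod: "ind j l * (\<Prod>w\<in>X. g j w l)
      = indicator {l. l p = j \<and> (\<forall>q\<in>(\<Union>w\<in>X. T w). j < l q)} l" if "X \<subseteq> W" for j X l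
  proof -
    have "finite X" using that W finite_subset by blast
    then have "(\<Prod>w\<in>X. g j w l) = indicator {l. \<forall>q\<in>(\<Union>w\<in>X. T w). j < l q} l"
      by (induction X rule: finite_induct) (auto simp: g_def indicator_def)
    then show ?thesis by (auto simp: ind_def indicator_def)
  qed
  have ne: "{..<N} \<noteq> {}" using N by auto
  have finM: "finite (set_pmf M)"
    unfolding M_def using Q ne by (auto simp: set_Pi_pmf intro!: finite_PiE_dflt)
  have intM: "integrable (measure_pmf M) h" for h :: "_ \<Rightarrow> real"
    using finM by (rule integrable_measure_pmf_finite)
  have E_term: "measure_pmf.expectation M (\<lambda>l. ind j l * (\<Prod>w\<in>W. 1 - g j w l))
      = (1 / real N) * (\<Prod>w\<in>W. 1 - x j ^ card (T w))" if j: "j < N" for j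
  proof -
    have "measure_pmf.expectation M (\<lambda>l. ind j l * (\<Prod>w\<in>W. 1 - g j w l))
      = measure_pmf.expectation M (\<lambda>l. \<Sum>X\<in>Pow W. (- 1) ^ card X *
          indicator {l. l p = j \<and> (\<forall>q\<in>(\<Union>w\<in>X. T w). j < l q)} l)"
    proof (intro Bochner_Integration.integral_cong refl)
      fix l
      have "ind j l * (\<Prod>w\<in>W. 1 - g j w l)
        = (\<Sum>X\<in>Pow W. ind j l * ((- 1) ^ card X * (\<Prod>w\<in>X. g j w l)))"
        using W by (simp add: prod_diff_conv_sum sum_distrib_left)
      also have "\<dots> = (\<Sum>X\<in>Pow W. (- 1) ^ card X *
          indicator {l. l p = j \<and> (\<forall>q\<in>(\<Union>w\<in>X. T w). j < l q)} l)"
      proof (intro sum.cong refl)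
        fix X assume "X \<in> Pow W"
        then show "ind j l * ((- 1) ^ card X * (\<Prod>w\<in>X. g j w l)) = (- 1) ^ card X *
            indicator {l. l p = j \<and> (\<forall>q\<in>(\<Union>w\<in>X. T w). j < l q)} l"
          by (simp only: g_prod[symmetric] mult.left_commute PowD)
      qed
      finally show "ind j l * (\<Prod>w\<in>W. 1 - g j w l) = (\<Sum>X\<in>Pow W. (- 1) ^ card X *
          indicator {l. l p = j \<and> (\<forall>q\<in>(\<Union>w\<in>X. T w). j < l q)} l)" .
    qed
    also have "\<dots> = (\<Sum>X\<in>Pow W. (- 1) ^ card X *
        measure_pmf.prob M {l. l p = j \<and> (\<forall>q\<in>(\<Union>w\<in>X. T w). j < l q)})"
      by (subst Bochner_Integration.integral_sum) (auto intro: intM)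
    also have "\<dots> = (\<Sum>X\<in>Pow W. (- 1) ^ card X * ((1 / real N) * (\<Prod>w\<in>X. x j ^ card (T w))))"
    proof (intro sum.cong refl arg_cong2[of _ _ _ _ "(*)"])
      fix X assume X: "X \<in> Pow W"
      have "measure_pmf.prob M {l. l p = j \<and> (\<forall>q\<in>(\<Union>w\<in>X. T w). j < l q)}
        = (1 / real N) * x j ^ card (\<Union>w\<in>X. T w)" using X T(1) by (intro prod[OF j]) blast
      also have "card (\<Union>w\<in>X. T w) = (\<Sum>w\<in>X. card (T w))"
      proof (rule card_UN_disjoint)
        show "finite X" using X W finite_subset by blast
        show "\<forall>w\<in>X. finite (T w)" using X finT by blast
        show "\<forall>w\<in>X. \<forall>w'\<in>X. w \<noteq> w' \<longrightarrow> T w \<inter> T w' = {}" using X disj by blast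
      qed
      finally show "measure_pmf.prob M {l. l p = j \<and> (\<forall>q\<in>(\<Union>w\<in>X. T w). j < l q)}
        = (1 / real N) * (\<Prod>w\<in>X. x j ^ card (T w))" by (simp add: power_sum)
    qed
    also have "\<dots> = (1 / real N) * (\<Prod>w\<in>W. 1 - x j ^ card (T w))"
      using W by (simp add: prod_diff_conv_sum sum_divide_distrib)
    finally show ?thesis .
  qed
  have "measure_pmf.prob M {l. \<forall>w\<in>W. \<not> (\<forall>q\<in>T w. l p < l q)}
    = measure_pmf.expectation M (indicator {l. \<forall>w\<in>W. \<not> (\<forall>q\<in>T w. l p < l q)})" by simp
  also have "\<dots> = measure_pmf.expectation M (\<lambda>l. \<Sum>j<N. ind j l * (\<Prod>w\<in>W. 1 - g j w l))"
  proof (intro integral_cong_AE AE_pmfI)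
    fix l assume "l \<in> set_pmf M"
    then have lp: "l p < N"
      unfolding M_def using Q ne by (auto simp: set_Pi_pmf PiE_dflt_def)
    have "(\<Sum>j<N. ind j l * (\<Prod>w\<in>W. 1 - g j w l))
      = (\<Sum>j<N. if j = l p then (\<Prod>w\<in>W. 1 - g j w l) else 0)"
      by (intro sum.cong) (auto simp: ind_def)
    also have "\<dots> = (\<Prod>w\<in>W. 1 - g (l p) w l)" using lp by simp
    also have "\<dots> = indicator {l. \<forall>w\<in>W. \<not> (\<forall>q\<in>T w. l p < l q)} l"
      using W by (induction W rule: finite_induct) (auto simp: g_def indicator_def)
    finally show "indicator {l. \<forall>w\<in>W. \<not> (\<forall>q\<in>T w. l p < l q)} l
      = (\<Sum>j<N. ind j l * (\<Prod>w\<in>W. 1 - g j w l))" by simp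
  qed auto
  also have "\<dots> = (\<Sum>j<N. (1 / real N) * (\<Prod>w\<in>W. 1 - x j ^ card (T w)))"
    using E_term by (subst Bochner_Integration.integral_sum) (auto intro: intM)
  also have "\<dots> \<le> (\<Sum>j<N. (1 / real N) * (\<Prod>w\<in>W. 1 - x j ^ a))"
    using x01 T(2) by (intro sum_mono mult_left_mono prod_mono)
      (auto intro!: power_decreasing power_le_one)
  also have "\<dots> = (\<Sum>j<N. (1 - x j ^ a) ^ card W) / real N" by (simp add: sum_divide_distrib)
  \<comment> \<open>Reversing the order of summation sends N - Suc j to j.\<close>
  also have "(\<Sum>j<N. (1 - x j ^ a) ^ card W) = (\<Sum>j<N. (1 - (real j / real N) ^ a) ^ card W)"
    unfolding x_def by (rule sum.nat_diff_reindex)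
  finally show ?thesis by (simp add: M_def)
qed

section \<open>The hopping number of a regular graph with few short cycles\<close>

context path_pieces
begin

lemma labelled_forces:
  fixes l :: "'p \<Rightarrow> nat"
  assumes G: "pair_graph G" "pverts G = V" "\<And>v. neighbours G v = E `` {v}"
    and b: "\<And>u. u \<in> good \<Longrightarrow> b u \<in> E `` {u}" "\<And>u. u \<in> good \<Longrightarrow> \<pi> (b u) = \<pi> u"
      "\<And>u. u \<in> good \<Longrightarrow> \<iota> u = Suc (\<iota> (b u))"
      "\<And>u w x. u \<in> good \<Longrightarrow> w \<in> E `` {u} - {b u} \<Longrightarrow> x \<in> insert w (E `` {w}) \<Longrightarrow> x \<noteq> u \<Longrightarrow>
        \<pi> x = \<pi> u \<Longrightarrow> \<iota> u < \<iota> x"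
    and U: "U \<subseteq> good"
      "\<And>u. u \<in> U \<Longrightarrow> \<exists>w\<in>E `` {u} - {b u}. \<forall>q\<in>\<pi> ` insert w (E `` {w}) - {\<pi> u}. l (\<pi> u) < l q"
  shows "hopping_number G + card U \<le> card V"
proof -
  \<comment> \<open>Lexicographic order, label before position, as positions are below L. Pieces
    with equal labels interleave, which does no harm: the condition on w demands strictly larger
    labels on all other pieces.\<close>
  define r where "r v = l (\<pi> v) * L + \<iota> v" for v
  obtain w where w: "w u \<in> E `` {u} - {b u}"
    "\<forall>q\<in>\<pi> ` insert (w u) (E `` {w u}) - {\<pi> u}. l (\<pi> u) < l q" if "u \<in> U" for u
    using U(2) by metis
  have good_V: "u \<in> V" if "u \<in> good" for u using that by (simp add: good_def)
  have "hopping_number G + card U \<le> card (pverts G)"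
  proof (rule hopping_number_le_ranked_forces[where r = r and b = b and w = w])
    show "pair_graph G" by fact
    show "U \<subseteq> pverts G" using U(1) G good_V by auto
    show "inj_on b U"
    proof (rule inj_onI)
      fix u u' assume u: "u \<in> U" "u' \<in> U" "b u = b u'"
      then have "\<pi> u = \<pi> u'" "\<iota> u = \<iota> u'" using b(2,3) U(1) by (metis subsetD)+
      then show "u = u'" using idx_inj[of u u'] good_V U(1) u by blast
    qed
    show "b u \<in> neighbours G u" if "u \<in> U" for u using b(1) U(1) that G by auto
    show "r (b u) < r u" if "u \<in> U" for u using b(2)[of u] b(3)[of u] U(1) that by (auto simp: r_def)
    show "w u \<in> neighbours G u" if "u \<in> U" for u using w(1)[OF that] G by auto
    show "r u < r x" if u: "u \<in> U" and x: "x \<in> insert (w u) (neighbours G (w u))" "x \<noteq> u" for u x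
    proof (cases "\<pi> x = \<pi> u")
      case True
      then have "\<iota> u < \<iota> x" using b(4)[OF _ w(1)[OF u], of x] U(1) u x G by auto
      then show ?thesis using True by (simp add: r_def)
    next
      case False
      then have "l (\<pi> u) < l (\<pi> x)" using w(2)[OF u] x G by auto
      then have "Suc (l (\<pi> u)) * L \<le> l (\<pi> x) * L" by (intro mult_le_mono1) auto
      moreover have "\<iota> u < L" using idx_less good_V U(1) u by auto
      ultimately show ?thesis by (simp add: r_def)
    qed
  qed
  then show ?thesis using G by simp
qed

lemma hopping_number_le_pieces:
  assumes G: "pair_graph G" "pverts G = V" "\<And>v. neighbours G v = E `` {v}"
    and d: "3 \<le> d" and N: "0 < N"
  shows "real (hopping_number G) \<le> real (card (V - good))
    + (\<Sum>j<N. (1 - (real j / real N) ^ (d - 2)) ^ (d - 1)) / real N * real (card V)"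
proof -
  define f where "f = (\<Sum>j<N. (1 - (real j / real N) ^ (d - 2)) ^ (d - 1)) / real N"
  have f0: "0 \<le> f" unfolding f_def
    by (intro divide_nonneg_nonneg sum_nonneg) (auto simp: power_le_one)
  define R where "R u b \<longleftrightarrow> b \<in> E `` {u} \<and> \<pi> b = \<pi> u \<and> \<iota> u = Suc (\<iota> b) \<and>
    (\<forall>w\<in>E `` {u} - {b}. card (\<pi> ` insert w (E `` {w}) - {\<pi> u}) \<le> d - 2) \<and>
    (\<forall>w\<in>E `` {u} - {b}. \<forall>w'\<in>E `` {u} - {b}. w \<noteq> w' \<longrightarrow>
      (\<pi> ` insert w (E `` {w}) - {\<pi> u}) \<inter> (\<pi> ` insert w' (E `` {w'}) - {\<pi> u}) = {}) \<and>
    (\<forall>w\<in>E `` {u} - {b}. \<forall>x\<in>insert w (E `` {w}). x \<noteq> u \<longrightarrow> \<pi> x = \<pi> u \<longrightarrow> \<iota> u < \<iota> x)"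
    for u b
  have "\<exists>b. R u b" if u: "u \<in> good" for u
  proof (rule good_vertex[OF u d])
    fix b
    assume "b \<in> E `` {u}" "\<pi> b = \<pi> u" "\<iota> u = Suc (\<iota> b)"
      "\<And>w. w \<in> E `` {u} - {b} \<Longrightarrow> card (\<pi> ` insert w (E `` {w}) - {\<pi> u}) \<le> d - 2"
      "\<And>w w'. w \<in> E `` {u} - {b} \<Longrightarrow> w' \<in> E `` {u} - {b} \<Longrightarrow> w \<noteq> w' \<Longrightarrow>
        (\<pi> ` insert w (E `` {w}) - {\<pi> u}) \<inter> (\<pi> ` insert w' (E `` {w'}) - {\<pi> u}) = {}"
      "\<And>w x. w \<in> E `` {u} - {b} \<Longrightarrow> x \<in> insert w (E `` {w}) \<Longrightarrow> x \<noteq> u \<Longrightarrow> \<pi> x = \<pi> u \<Longrightarrow> \<iota> u < \<iota> x"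
    then have "R u b" unfolding R_def by (intro conjI ballI impI)
    then show ?thesis ..
  qed
  then obtain b where R: "\<And>u. u \<in> good \<Longrightarrow> R u (b u)" by metis
  note b = R[unfolded R_def, THEN conjunct1]
    R[unfolded R_def, THEN conjunct2, THEN conjunct1]
    R[unfolded R_def, THEN conjunct2, THEN conjunct2, THEN conjunct1]
    R[unfolded R_def, THEN conjunct2, THEN conjunct2, THEN conjunct2, THEN conjunct1]
    R[unfolded R_def, THEN conjunct2, THEN conjunct2, THEN conjunct2, THEN conjunct2, THEN conjunct1]
    R[unfolded R_def, THEN conjunct2, THEN conjunct2, THEN conjunct2, THEN conjunct2, THEN conjunct2]
  define W where "W u = E `` {u} - {b u}" for u
  define T where "T u w = \<pi> ` insert w (E `` {w}) - {\<pi> u}" for u w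
  define M where "M = Pi_pmf (\<pi> ` V) (0::nat) (\<lambda>_. pmf_of_set {..<N})"
  define fail where "fail u = {l :: 'p \<Rightarrow> nat. \<forall>w\<in>W u. \<not> (\<forall>q\<in>T u w. l (\<pi> u) < l q)}" for u
  have good_V: "good \<subseteq> V" by (auto simp: good_def)
  then have fin_good: "finite good" using finite_V finite_subset by blast
  have prob_fail: "measure_pmf.prob M (fail u) \<le> f" if u: "u \<in> good" for u
  proof -
    have uV: "u \<in> V" using good_V u by auto
    have "card (W u) = d - 1" using regular[OF uV] b(1)[OF u] finite_Image by (simp add: W_def)
    moreover have "measure_pmf.prob M (fail u)
      \<le> (\<Sum>j<N. (1 - (real j / real N) ^ (d - 2)) ^ card (W u)) / real N"
      unfolding M_def fail_def
    proof (rule prob_no_group_above)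
      show "finite (\<pi> ` V)" "\<pi> u \<in> \<pi> ` V" "finite (W u)" "0 < N"
        using finite_V uV N finite_Image by (auto simp: W_def)
      show "T u w \<subseteq> \<pi> ` V - {\<pi> u}" if "w \<in> W u" for w
        using that E_sub by (auto simp: T_def W_def)
      show "card (T u w) \<le> d - 2" if "w \<in> W u" for w
        using b(4)[OF u, rule_format, OF that[unfolded W_def]] by (simp only: T_def)
      show "T u w \<inter> T u w' = {}" if "w \<in> W u" "w' \<in> W u" "w \<noteq> w'" for w w'
        using b(5)[OF u, rule_format, OF that(1,2)[unfolded W_def] that(3)] by (simp only: T_def)
    qed
    ultimately show ?thesis by (simp add: f_def)
  qed
  define X where "X l = (\<Sum>u\<in>good. indicator (fail u) l :: real)" for l
  have ne: "{..<N} \<noteq> {}" using N by auto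
  have finM: "finite (set_pmf M)"
    unfolding M_def using finite_V ne by (auto simp: set_Pi_pmf intro!: finite_PiE_dflt)
  have intM: "integrable (measure_pmf M) h" for h :: "_ \<Rightarrow> real"
    using finM by (rule integrable_measure_pmf_finite)
  have "measure_pmf.expectation M X = (\<Sum>u\<in>good. measure_pmf.prob M (fail u))"
    unfolding X_def by (subst Bochner_Integration.integral_sum) (auto intro: intM)
  also have "\<dots> \<le> (\<Sum>u\<in>good. f)" by (intro sum_mono prob_fail)
  finally have EX: "measure_pmf.expectation M X \<le> f * real (card good)" by (simp add: mult.commute)
  \<comment> \<open>First moment method: some labelling has at most the expected number of failures,
    so the resulting bound on the hopping number is deterministic.\<close>
  have "\<exists>l. X l \<le> f * real (card good)"
  proof (rule ccontr)
    assume "\<not> ?thesis"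
    then have "f * real (card good) < X l" for l by (simp add: not_le)
    then have "f * real (card good) < measure_pmf.expectation M X"
      by (intro measure_pmf.expectation_greater intM) auto
    then show False using EX by simp
  qed
  then obtain l where l: "X l \<le> f * real (card good)" ..
  define U where "U = {u \<in> good. l \<notin> fail u}"
  have "X l = real (card {u \<in> good. l \<in> fail u})"
    unfolding X_def using fin_good by (simp add: indicator_def sum.If_cases Int_def)
  moreover have "card good = card U + card {u \<in> good. l \<in> fail u}"
    unfolding U_def using fin_good by (subst card_Un_disjoint[symmetric]) (auto intro!: arg_cong[where f = card])
  ultimately have cU: "real (card good) - f * real (card good) \<le> real (card U)" using l by simp
  have "hopping_number G + card U \<le> card V"
  proof (rule labelled_forces[OF G])
    show "U \<subseteq> good" by (auto simp: U_def)
    show "\<exists>w\<in>E `` {u} - {b u}. \<forall>q\<in>\<pi> ` insert w (E `` {w}) - {\<pi> u}. l (\<pi> u) < l q"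
      if "u \<in> U" for u
      using that unfolding U_def fail_def T_def W_def by blast
  qed (use b(1,2,3,6) in blast)+
  moreover have "card V = card good + card (V - good)"
    using good_V finite_V by (metis card_Diff_subset card_mono finite_subset le_add_diff_inverse)
  moreover have "f * real (card good) \<le> f * real (card V)"
    using f0 good_V finite_V by (intro mult_left_mono) (auto intro: card_mono)
  ultimately show ?thesis using cU unfolding f_def[symmetric] by linarith
qed

end

text \<open>The parameter m is both the piece length and the number of labels. With z vertices on
  short cycles there are at most 4 z + 5 n/m pieces. Each piece has at most two ends, and each end
  spoils at most d + 1 vertices; together with the z vertices themselves and the Riemann error n/m
  this gives the coefficients 8 d + 9 = 1 + 4 (2 d + 2) and 10 d + 11 = 1 + 5 (2 d + 2).\<close>

lemma hopping_number_regular_le: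
  fixes G :: "'a pair_pre_digraph"
  assumes G: "pair_graph G" "\<And>v. v \<in> pverts G \<Longrightarrow> card (neighbours G v) = d"
    and d: "3 \<le> d" and m: "0 < m"
  shows "real (hopping_number G) \<le>
    (\<Prod>i = 1..d - 1. real i * real (d - 2) / (real i * real (d - 2) + 1)) * real (card (pverts G))
    + (8 * real d + 9) * real (card (short_cycle_verts (parcs G) (m + 3)))
    + (10 * real d + 11) * real (card (pverts G)) / real m"
proof -
  define V E where "V = pverts G" and "E = parcs G"
  define z where "z = real (card (short_cycle_verts E (m + 3)))"
  define n where "n = real (card V)"
  define c where "c = (\<Prod>i = 1..d - 1. real i * real (d - 2) / (real i * real (d - 2) + 1))"
  interpret G: pair_graph G by fact
  have nbr: "neighbours G v = E `` {v}" for v by (auto simp: neighbours_def E_def)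
  have reg: "card (E `` {v}) = d" if "v \<in> V" for v using G(2) that nbr by (simp add: V_def)
  have "E \<subseteq> V \<times> V" by (auto simp: E_def V_def intro: G.in_arcsD1 G.in_arcsD2)
  moreover have "sym E" "irrefl E"
    by (auto simp: E_def sym_def irrefl_def intro: G.arcs_symmetric dest: G.no_loops')
  ultimately have graph: "simple_graph V E"
    using G.pair_finite_verts by (simp add: simple_graph_def V_def)
  obtain P where P: "path_cover V E P" "real (card P) \<le> 4 * (z + n / real (m + 3))"
    using regular_path_cover[OF graph reg, of "m + 3"] d by (auto simp: z_def n_def)
  obtain \<pi> :: "'a \<Rightarrow> 'a list \<times> nat" and \<iota> where pieces: "path_pieces V E d m \<pi> \<iota>"
    and card_pieces: "real (card (\<pi> ` V)) \<le> real (card P) + real (card V) / real m"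
    by (rule path_cover_pieces[OF graph reg P(1) m])
  interpret path_pieces V E d m \<pi> \<iota> by fact
  have "n / real (m + 3) \<le> n / real m" using m by (intro divide_left_mono) (auto simp: n_def)
  then have "real (card (\<pi> ` V)) \<le> 4 * z + 5 * (n / real m)"
    using card_pieces P(2) by (simp add: n_def)
  then have "(2 * real d + 2) * real (card (\<pi> ` V)) \<le> (2 * real d + 2) * (4 * z + 5 * (n / real m))"
    by (rule mult_left_mono) simp
  moreover have "real ((d + 1) * (2 * card (\<pi> ` V))) = (2 * real d + 2) * real (card (\<pi> ` V))"
    by (simp add: algebra_simps)
  ultimately have "real ((d + 1) * (2 * card (\<pi> ` V))) \<le> (2 * real d + 2) * (4 * z + 5 * (n / real m))"
    by simp
  moreover have "real (card (V - good)) \<le> z + real ((d + 1) * (2 * card (\<pi> ` V)))"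
    using card_not_good unfolding z_def by (metis of_nat_add of_nat_le_iff)
  ultimately have bad: "real (card (V - good)) \<le> z + (2 * real d + 2) * (4 * z + 5 * (n / real m))"
    by linarith
  have "real (hopping_number G) \<le> real (card (V - good))
    + (\<Sum>j<m. (1 - (real j / real m) ^ (d - 2)) ^ (d - 1)) / real m * n"
    unfolding n_def by (rule hopping_number_le_pieces[OF G(1) V_def[symmetric] nbr d m])
  also have "\<dots> \<le> z + (2 * real d + 2) * (4 * z + 5 * (n / real m)) + (c + 1 / real m) * n"
    using d m bad riemann_sum_one_minus_power[of "d - 2" m "d - 1"]
    by (intro add_mono mult_right_mono) (auto simp: c_def n_def)
  also have "\<dots> = c * n + (8 * real d + 9) * z + (10 * real d + 11) * n / real m"
    by (simp add: algebra_simps add_divide_distrib)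
  finally show ?thesis by (simp add: c_def n_def z_def V_def E_def)
qed

section \<open>Short cycles in random regular graphs\<close>

definition regular_rels :: "nat \<Rightarrow> nat \<Rightarrow> nat rel set" where
  "regular_rels n d = {E. simple_graph {..<n} E \<and> (\<forall>v<n. card (E `` {v}) = d)}"

lemma regular_graphs_eq_image:
  "regular_graphs n d = (\<lambda>E. \<lparr>pverts = {..<n}, parcs = E\<rparr>) ` regular_rels n d"
proof -
  have outdeg: "out_degree (with_proj G) v = card (parcs G `` {v})" for G :: "nat pair_pre_digraph" and v
  proof -
    have "out_arcs (with_proj G) v = Pair v ` (parcs G `` {v})" by (auto simp: out_arcs_def)
    then show ?thesis unfolding out_degree_def by (simp add: card_image inj_on_def)
  qed
  have iff: "G \<in> regular_graphs n d \<longleftrightarrow> pverts G = {..<n} \<and> parcs G \<in> regular_rels n d"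
    for G :: "nat pair_pre_digraph"
  proof
    assume G: "G \<in> regular_graphs n d"
    then interpret pair_graph G by (simp add: regular_graphs_def)
    have "parcs G \<subseteq> pverts G \<times> pverts G" by (auto intro: in_arcsD1 in_arcsD2)
    moreover have "sym (parcs G)" "irrefl (parcs G)"
      by (auto simp: sym_def irrefl_def intro: arcs_symmetric dest: no_loops')
    ultimately show "pverts G = {..<n} \<and> parcs G \<in> regular_rels n d"
      using G by (auto simp: regular_graphs_def regular_rels_def simple_graph_def outdeg)
  next
    assume G: "pverts G = {..<n} \<and> parcs G \<in> regular_rels n d"
    then have E: "parcs G \<subseteq> {..<n} \<times> {..<n}" "sym (parcs G)" "irrefl (parcs G)"
      by (auto simp: regular_rels_def simple_graph_def)
    have "pair_graph G"
    proof
      show "fst e \<in> pverts G" "snd e \<in> pverts G" if "e \<in> parcs G" for e using G E that by auto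
      show "finite (pverts G)" "finite (parcs G)" using G E(1) finite_subset by auto
      show "fst e \<noteq> snd e" if "e \<in> parcs G" for e
        using E(3) that by (cases e) (auto dest: irreflD)
      show "symmetric (with_proj G)" using E(2) by (simp add: symmetric_def)
    qed
    then show "G \<in> regular_graphs n d"
      using G by (auto simp: regular_graphs_def regular_rels_def outdeg)
  qed
  show ?thesis
  proof (intro equalityI subsetI)
    fix G assume "G \<in> regular_graphs n d"
    then show "G \<in> (\<lambda>E. \<lparr>pverts = {..<n}, parcs = E\<rparr>) ` regular_rels n d"
      using iff by (intro image_eqI[of _ _ "parcs G"]) auto
  qed (auto simp: iff)
qed

lemma finite_regular_rels: "finite (regular_rels n d)"
  by (rule finite_subset[of _ "Pow ({..<n} \<times> {..<n})"]) (auto simp: regular_rels_def simple_graph_def)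

text \<open>The witness is the circulant graph on the integers modulo \<open>n\<close> with connection set \<open>D\<close>.\<close>
lemma regular_rels_nonempty:
  assumes "d < n" "even (d * n)"
  shows "regular_rels n d \<noteq> {}"
proof -
  define h where "h = d div 2"
  \<comment> \<open>D is closed under negation modulo n. For odd d the one extra element must be its
    own negative; n is then even and n/2 is available.\<close>
  define D where "D = {1..h} \<union> {n - h..<n} \<union> (if odd d then {n div 2} else {})"
  have h: "2 * h < n" using assms by (auto simp: h_def)
  have n_even: "n = 2 * (n div 2)" if "odd d" using assms that by auto
  have h2: "h < n div 2" if "odd d" using n_even[OF that] assms that unfolding h_def by presburger
  have D: "D \<subseteq> {1..<n}" "finite D" using h h2 n_even by (auto simp: D_def)
  have symD: "n - x \<in> D" if "x \<in> D" for x using that h h2 n_even by (auto simp: D_def split: if_splits)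
  have cardD: "card D = d"
  proof -
    have "card ({1..h} \<union> {n - h..<n}) = 2 * h" using h by (subst card_Un_disjoint) auto
    moreover have "n div 2 \<notin> {1..h} \<union> {n - h..<n}" if "odd d" using h2[OF that] n_even[OF that] by auto
    ultimately show ?thesis unfolding D_def h_def by (auto simp: Un_commute)
  qed
  define E where "E = {(u, v). u < n \<and> v < n \<and> (v + n - u) mod n \<in> D}"
  have zero: "0 \<notin> D" using D by auto
  have "simple_graph {..<n} E"
  proof -
    have "sym E"
    proof (rule symI)
      fix u v assume uv: "(u, v) \<in> E"
      then have "u \<noteq> v" using zero by (auto simp: E_def)
      have un: "u < n" and vn: "v < n" and D': "(v + n - u) mod n \<in> D" using uv by (simp_all add: E_def)
      have "(u + n - v) mod n = n - (v + n - u) mod n"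
      proof (cases "u < v")
        case True
        then have "v + n - u = (v - u) + n" "v - u < n" using un vn by linarith+
        then have "(v + n - u) mod n = v - u" by (simp only: mod_add_self2 mod_less)
        moreover have "u + n - v < n" using True un vn by linarith
        then have "(u + n - v) mod n = u + n - v" by (rule mod_less)
        ultimately show ?thesis using True un vn by linarith
      next
        case False
        then have "u + n - v = (u - v) + n" "u - v < n" using un vn by linarith+
        then have "(u + n - v) mod n = u - v" by (simp only: mod_add_self2 mod_less)
        moreover have "v + n - u < n" using False \<open>u \<noteq> v\<close> un vn by linarith
        then have "(v + n - u) mod n = v + n - u" by (rule mod_less)
        ultimately show ?thesis using False un vn by linarith
      qed
      then show "(v, u) \<in> E" using un vn symD[OF D'] by (simp add: E_def)
    qed
    moreover have "irrefl E" using zero by (auto simp: E_def irrefl_def)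
    ultimately show ?thesis by (auto simp: simple_graph_def E_def)
  qed
  moreover have "card (E `` {u}) = d" if u: "u < n" for u
  proof -
    have "bij_betw (\<lambda>x. (u + x) mod n) D (E `` {u})"
    proof (rule bij_betw_byWitness[where f' = "\<lambda>v. (v + n - u) mod n"])
      have shift: "((u + x) mod n + n - u) mod n = x" if x: "x < n" for x
      proof (cases "u + x < n")
        case True
        then have "(u + x) mod n + n - u = x + n" by simp
        then show ?thesis using x by (simp only: mod_add_self2 mod_less)
      next
        case False
        then have "(u + x) mod n = u + x - n" using u x by (simp add: mod_if)
        then have "(u + x) mod n + n - u = x" using False u by linarith
        then show ?thesis using x by simp
      qed
      then show "\<forall>x\<in>D. ((u + x) mod n + n - u) mod n = x" using D by auto
      have "(u + (v + n - u) mod n) mod n = v" if v: "v < n" for v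
      proof (cases "u \<le> v")
        case True
        then have "v + n - u = (v - u) + n" "v - u < n" using v by linarith+
        then have "(v + n - u) mod n = v - u" by (simp only: mod_add_self2 mod_less)
        then have "u + (v + n - u) mod n = v" using True by linarith
        then show ?thesis using v by simp
      next
        case False
        then have "v + n - u < n" using u by linarith
        then have "(v + n - u) mod n = v + n - u" by (rule mod_less)
        then have "u + (v + n - u) mod n = v + n" using u by linarith
        then show ?thesis using v by (simp only: mod_add_self2 mod_less)
      qed
      then show "\<forall>v\<in>E `` {u}. (u + (v + n - u) mod n) mod n = v" by (auto simp: E_def)
      show "(\<lambda>x. (u + x) mod n) ` D \<subseteq> E `` {u}" using D shift u by (auto simp: E_def)
      show "(\<lambda>v. (v + n - u) mod n) ` (E `` {u}) \<subseteq> D" by (auto simp: E_def)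
    qed
    then show ?thesis using cardD by (simp add: bij_betw_same_card)
  qed
  ultimately show ?thesis by (auto simp: regular_rels_def)
qed

section \<open>Counting short cycles by switchings\<close>

definition walks :: "nat \<Rightarrow> nat rel \<Rightarrow> nat \<Rightarrow> nat list set" where
  "walks n E k = {xs. length xs = Suc k \<and> hd xs < n \<and> successively (\<lambda>x y. (x, y) \<in> E) xs}"

lemma card_walks_le:
  assumes "E \<in> regular_rels n d"
  shows "finite (walks n E k) \<and> card (walks n E k) \<le> n * d ^ k"
proof (induction k)
  case 0
  have "walks n E 0 = (\<lambda>v. [v]) ` {..<n}" by (auto simp: walks_def length_Suc_conv)
  then show ?case by (simp add: card_image inj_on_def)
next
  case (Suc k)
  have E: "E \<subseteq> {..<n} \<times> {..<n}" "sym E" and reg: "\<And>v. v < n \<Longrightarrow> card (E `` {v}) = d"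
    using assms by (auto simp: regular_rels_def simple_graph_def)
  have fin: "finite (E `` S)" for S
    using E finite_subset[of "E `` S" "{..<n}"] by auto
  define S where "S = (SIGMA xs:walks n E k. E `` {hd xs})"
  have "walks n E (Suc k) \<subseteq> (\<lambda>(xs, v). v # xs) ` S"
  proof
    fix ys assume ys: "ys \<in> walks n E (Suc k)"
    then obtain v xs where vx: "ys = v # xs" "length xs = Suc k" by (auto simp: walks_def length_Suc_conv)
    then have "(v, hd xs) \<in> E" "successively (\<lambda>x y. (x, y) \<in> E) xs"
      using ys by (auto simp: walks_def successively_Cons)
    then have "(xs, v) \<in> S" using E vx by (auto simp: S_def walks_def dest: symD)
    then show "ys \<in> (\<lambda>(xs, v). v # xs) ` S" using vx by force
  qed
  moreover have finS: "finite S" using Suc fin by (auto simp: S_def)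
  moreover have "card S = (\<Sum>xs\<in>walks n E k. d)"
    unfolding S_def using Suc fin reg by (subst card_SigmaI) (auto simp: walks_def)
  then have "card S \<le> n * d ^ Suc k" using Suc by simp
  ultimately show ?case
    by (meson card_image_le card_mono finite_imageI finite_subset le_trans)
qed

text \<open>Each cycle occurs once for every starting vertex and direction, which only strengthens
  the upper bounds on the counts.\<close>

definition cycles :: "nat \<Rightarrow> nat rel \<Rightarrow> nat list set" where
  "cycles k E = {xs. is_cycle E xs \<and> length xs = k}"

definition switch :: "'a rel \<Rightarrow> 'a \<Rightarrow> 'a \<Rightarrow> 'a \<Rightarrow> 'a \<Rightarrow> 'a rel" where
  "switch E y x a b = (E - {(y, x), (x, y), (a, b), (b, a)}) \<union> {(y, a), (a, y), (x, b), (b, x)}"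

text \<open>The inverse is again a switching, with x and a exchanged; this makes switching injective
  once the four vertices are recorded.\<close>

lemma switch_switch:
  assumes "sym E" "(y, x) \<in> E" "(a, b) \<in> E" "(y, a) \<notin> E" "(x, b) \<notin> E"
    and "x \<noteq> a" "y \<noteq> b" "x \<noteq> y" "a \<noteq> b" "a \<noteq> y" "b \<noteq> x"
  shows "switch (switch E y x a b) y a x b = E"
proof -
  have "(x, y) \<in> E" "(b, a) \<in> E" "(a, y) \<notin> E" "(b, x) \<notin> E"
    using assms(1-5) by (auto dest: symD)
  then show ?thesis using assms unfolding switch_def by auto
qed

lemma switch_regular:
  assumes E: "E \<in> regular_rels n d" and e: "(y, x) \<in> E" "(a, b) \<in> E" "(y, a) \<notin> E" "(x, b) \<notin> E"
    and ne: "x \<noteq> a" "y \<noteq> b" "x \<noteq> y" "a \<noteq> b" "a \<noteq> y" "b \<noteq> x"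
  shows "switch E y x a b \<in> regular_rels n d"
proof -
  have EV: "E \<subseteq> {..<n} \<times> {..<n}" "sym E" "irrefl E" and reg: "\<And>v. v < n \<Longrightarrow> card (E `` {v}) = d"
    using E by (auto simp: regular_rels_def simple_graph_def)
  have e': "(x, y) \<in> E" "(b, a) \<in> E" "(a, y) \<notin> E" "(b, x) \<notin> E" using e EV(2) by (auto dest: symD)
  have fin: "finite (E `` S)" for S
    using EV finite_subset[of "E `` S" "{..<n}"] by auto
  have "simple_graph {..<n} (switch E y x a b)"
    using EV e ne unfolding simple_graph_def switch_def by (auto simp: sym_def irrefl_def)
  moreover have "card (switch E y x a b `` {v}) = d" if v: "v < n" for v
  proof -
    have swap: "card (insert s (E `` {v} - {t})) = d" if "(v, t) \<in> E" "(v, s) \<notin> E" for s t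
      using that reg[OF v] fin card_Suc_Diff1[of "E `` {v}" t] by (simp add: card_insert_if)
    consider "v = y" | "v = x" | "v = a" | "v = b" | "v \<notin> {y, x, a, b}" by blast
    then show ?thesis
    proof cases
      case 1
      then have "switch E y x a b `` {v} = insert a (E `` {v} - {x})"
        using ne unfolding switch_def by auto
      then show ?thesis using swap[of x a] 1 e by simp
    next
      case 2
      then have "switch E y x a b `` {v} = insert b (E `` {v} - {y})"
        using ne unfolding switch_def by auto
      then show ?thesis using swap[of y b] 2 e e' by simp
    next
      case 3
      then have "switch E y x a b `` {v} = insert y (E `` {v} - {b})"
        using ne unfolding switch_def by auto
      then show ?thesis using swap[of b y] 3 e e' by simp
    next
      case 4
      then have "switch E y x a b `` {v} = insert x (E `` {v} - {a})"
        using ne unfolding switch_def by auto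
      then show ?thesis using swap[of a x] 4 e e' by simp
    next
      case 5
      then have "switch E y x a b `` {v} = E `` {v}" unfolding switch_def by auto
      then show ?thesis using reg[OF v] by simp
    qed
  qed
  ultimately show ?thesis by (auto simp: regular_rels_def)
qed

lemma card_arcs:
  assumes "E \<in> regular_rels n d"
  shows "card E = n * d" "finite E"
proof -
  have E: "E \<subseteq> {..<n} \<times> {..<n}" and reg: "\<And>v. v < n \<Longrightarrow> card (E `` {v}) = d"
    using assms by (auto simp: regular_rels_def simple_graph_def)
  show "finite E" using finite_subset[OF E] by simp
  have fin: "finite (E `` S)" for S using E finite_subset[of "E `` S" "{..<n}"] by auto
  have "E = (SIGMA v:{..<n}. E `` {v})" using E by auto
  then have "card E = card (SIGMA v:{..<n}. E `` {v})" by simp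
  also have "\<dots> = n * d"
    using reg fin by (subst card_SigmaI) auto
  finally show "card E = n * d" .
qed

text \<open>
  Replacing the closing edge \<open>{hd xs, last xs}\<close> of a cycle and another edge \<open>{a, b}\<close> by
  \<open>{hd xs, a}\<close> and \<open>{last xs, b}\<close> maps (graph, cycle, arc) injectively to
  (graph, path, neighbours of its ends).
\<close>
lemma sum_card_cycles_le:
  assumes k: "3 \<le> k"
  shows "(n * d - 2 * ((k + d) * d)) * (\<Sum>E\<in>regular_rels n d. card (cycles k E))
    \<le> card (regular_rels n d) * (n * d ^ (k + 1))"
proof -
  define R where "R = regular_rels n d"
  \<comment> \<open>The arcs admissible for a switching: off the cycle, so that its other edges
    survive, and such that the two new edges are not yet present.\<close>
  define A where "A E xs = {(a, b) \<in> E. a \<notin> set xs \<union> E `` {hd xs} \<and> b \<notin> set xs \<union> E `` {last xs}}"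
    for E and xs :: "nat list"
  \<comment> \<open>After the switching the list is still a path on k vertices, and a, b are
    neighbours of its ends. The bound n d^(k-1) on paths and d^2 choices of a, b give n
    d^(k+1).\<close>
  define Q where "Q E = (SIGMA xs:{xs. is_path E xs \<and> length xs = k}. E `` {hd xs} \<times> E `` {last xs})"
    for E :: "nat rel"
  define X where "X = (SIGMA E:R. SIGMA xs:cycles k E. A E xs)"
  define Y where "Y = (SIGMA E:R. Q E)"
  define \<phi> where "\<phi> = (\<lambda>(E, xs, a, b). (switch E (hd xs) (last xs) a b, xs, a, b :: nat))"
  have finR: "finite R" by (simp add: R_def finite_regular_rels)
  have RD: "E \<subseteq> {..<n} \<times> {..<n}" "sym E" "irrefl E" "\<And>v. v < n \<Longrightarrow> card (E `` {v}) = d"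
    "\<And>v. finite (E `` {v})" "finite E" "card E = n * d" if "E \<in> R" for E
    using that card_arcs[of E n d] finite_subset[of "E `` _" "{..<n}"]
    by (auto simp: R_def regular_rels_def simple_graph_def)
  have paths: "xs \<in> walks n E (k - 1)" "set xs \<subseteq> {..<n}" if "E \<in> R" "is_path E xs" "length xs = k" for E xs
  proof -
    have adj: "(xs ! i, xs ! Suc i) \<in> E" if "Suc i < k" for i
      using \<open>is_path E xs\<close> \<open>length xs = k\<close> that by (auto simp: is_path_def successively_conv_nth)
    have lt: "xs ! i < n" if "i < k" for i
    proof (cases i)
      case 0
      then show ?thesis using adj[of 0] RD(1)[OF \<open>E \<in> R\<close>] k by auto
    next
      case (Suc j)
      then show ?thesis using adj[of j] RD(1)[OF \<open>E \<in> R\<close>] that by auto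
    qed
    show "set xs \<subseteq> {..<n}" using lt that(3) by (auto simp: in_set_conv_nth)
    have "xs \<noteq> []" using that(3) k by auto
    then have "hd xs < n" using lt[of 0] that(3) k by (simp add: hd_conv_nth)
    then show "xs \<in> walks n E (k - 1)" using that k by (auto simp: walks_def is_path_def)
  qed
  have ends: "hd xs < n" "last xs < n" if "E \<in> R" "is_path E xs" "length xs = k" for E xs
  proof -
    have "xs \<noteq> []" using that(3) k by auto
    then show "hd xs < n" "last xs < n" using paths(2)[OF that] hd_in_set last_in_set by blast+
  qed
  have cyc: "is_path E xs" "length xs = k" "(last xs, hd xs) \<in> E" if "xs \<in> cycles k E" for E xs
    using that by (auto simp: cycles_def is_cycle_def)
  have finQ: "finite (Q E)" and cardQ: "card (Q E) \<le> n * d ^ (k + 1)" if E: "E \<in> R" for E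
  proof -
    define S where "S = {xs. is_path E xs \<and> length xs = k}"
    have "S \<subseteq> walks n E (k - 1)" using paths(1)[OF E] by (auto simp: S_def)
    moreover note card_walks_le[of E n d "k - 1"]
    ultimately have S: "finite S" "card S \<le> n * d ^ (k - 1)"
      using E by (auto simp: R_def intro: finite_subset le_trans[OF card_mono])
    show "finite (Q E)" unfolding Q_def S_def[symmetric] using S RD[OF E] by auto
    have "card (Q E) = (\<Sum>xs\<in>S. d * d)"
      unfolding Q_def S_def[symmetric] using S RD[OF E] ends[OF E]
      by (subst card_SigmaI) (auto simp: card_cartesian_product S_def)
    also have "\<dots> \<le> n * d ^ (k - 1) * (d * d)" using S by simp
    also have "\<dots> = n * (d ^ (k - 1) * d ^ 2)" by (simp add: power2_eq_square)
    also have "d ^ (k - 1) * d ^ 2 = d ^ (k + 1)" using k by (simp flip: power_add)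
    finally show "card (Q E) \<le> n * d ^ (k + 1)" .
  qed
  have finC: "finite (cycles k E)" if E: "E \<in> R" for E
  proof (rule finite_subset)
    show "cycles k E \<subseteq> walks n E (k - 1)" using cyc paths(1)[OF E] by blast
    show "finite (walks n E (k - 1))" using card_walks_le E by (auto simp: R_def)
  qed
  \<comment> \<open>An arc fails through its tail a or its head b. Either way that vertex is one of
    at most k + d forbidden ones and has d arcs, hence twice (k + d) d.\<close>
  have cardA: "n * d - 2 * ((k + d) * d) \<le> card (A E xs)" if E: "E \<in> R" and xs: "xs \<in> cycles k E" for E xs
  proof -
    define B where "B v = (SIGMA a:(set xs \<union> E `` {v}). E `` {a})" for v
    have cardB: "card (B v) \<le> (k + d) * d" if v: "v < n" for v
    proof -
      have sub: "set xs \<union> E `` {v} \<subseteq> {..<n}" using paths(2)[OF E cyc(1,2)[OF xs]] RD(1)[OF E] by auto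
      have "card (B v) = (\<Sum>a\<in>set xs \<union> E `` {v}. card (E `` {a}))"
        unfolding B_def using RD[OF E] by (subst card_SigmaI) auto
      also have "\<dots> = (\<Sum>a\<in>set xs \<union> E `` {v}. d)" using RD(4)[OF E] sub by (intro sum.cong) auto
      also have "\<dots> = card (set xs \<union> E `` {v}) * d" by simp
      also have "card (set xs \<union> E `` {v}) \<le> card (set xs) + card (E `` {v})" by (rule card_Un_le)
      also have "\<dots> \<le> k + d" using RD(4)[OF E v] cyc(2)[OF xs] card_length[of xs] by simp
      finally show ?thesis by simp
    qed
    have finB: "finite (B v)" for v unfolding B_def using RD(5)[OF E] by auto
    have hl: "hd xs < n" "last xs < n" using ends[OF E cyc(1,2)[OF xs]] by auto
    have "E \<subseteq> A E xs \<union> (B (hd xs) \<union> prod.swap ` B (last xs))"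
    proof
      fix e assume e: "e \<in> E"
      obtain a b where ab: "e = (a, b)" by (cases e)
      have "(b, a) \<in> E" using e ab RD(2)[OF E] by (auto dest: symD)
      then have "b \<in> set xs \<union> E `` {last xs} \<Longrightarrow> (b, a) \<in> B (last xs)" by (auto simp: B_def)
      moreover have "a \<in> set xs \<union> E `` {hd xs} \<Longrightarrow> (a, b) \<in> B (hd xs)" using e ab by (auto simp: B_def)
      ultimately show "e \<in> A E xs \<union> (B (hd xs) \<union> prod.swap ` B (last xs))"
        using e ab unfolding A_def by (force simp: image_iff)
    qed
    moreover have finA: "finite (A E xs)"
      by (rule finite_subset[OF _ RD(6)[OF E]]) (auto simp: A_def)
    ultimately have "card E \<le> card (A E xs \<union> (B (hd xs) \<union> prod.swap ` B (last xs)))"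
      using finB by (intro card_mono) auto
    also have "\<dots> \<le> card (A E xs) + card (B (hd xs) \<union> prod.swap ` B (last xs))" by (rule card_Un_le)
    also have "card (B (hd xs) \<union> prod.swap ` B (last xs)) \<le> card (B (hd xs)) + card (prod.swap ` B (last xs))"
      by (rule card_Un_le)
    also have "card (prod.swap ` B (last xs)) \<le> card (B (last xs))" using finB by (rule card_image_le)
    finally show ?thesis using cardB[OF hl(1)] cardB[OF hl(2)] RD(7)[OF E] by linarith
  qed
  have switchable: "(hd xs, last xs) \<in> E" "(hd xs, a) \<notin> E" "(last xs, b) \<notin> E" "(a, b) \<in> E"
    "last xs \<noteq> a" "hd xs \<noteq> b" "last xs \<noteq> hd xs" "a \<noteq> b" "a \<noteq> hd xs" "b \<noteq> last xs"
    "a \<notin> set xs" "b \<notin> set xs"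
    if E: "E \<in> R" and xs: "xs \<in> cycles k E" and ab: "(a, b) \<in> A E xs" for E xs a b
  proof -
    have nonempty: "xs \<noteq> []" using cyc(2)[OF xs] k by auto
    then have hl: "hd xs \<in> set xs" "last xs \<in> set xs" by auto
    show "(hd xs, last xs) \<in> E" using cyc(3)[OF xs] RD(2)[OF E] by (auto dest: symD)
    then show "last xs \<noteq> hd xs" using RD(3)[OF E] by (auto dest: irreflD)
    show "(hd xs, a) \<notin> E" "(last xs, b) \<notin> E" "(a, b) \<in> E" "a \<notin> set xs" "b \<notin> set xs"
      using ab by (auto simp: A_def)
    then show "last xs \<noteq> a" "hd xs \<noteq> b" "a \<noteq> b" "a \<noteq> hd xs" "b \<noteq> last xs"
      using hl RD(3)[OF E] by (auto dest: irreflD)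
  qed
  have "inj_on \<phi> X"
  proof (rule inj_on_inverseI[where g = "\<lambda>(E, xs, a, b). (switch E (hd xs) a (last xs) b, xs, a, b)"])
    fix t assume "t \<in> X"
    then obtain E xs a b where t: "t = (E, xs, a, b)" "E \<in> R" "xs \<in> cycles k E" "(a, b) \<in> A E xs"
      by (auto simp: X_def)
    have "switch (switch E (hd xs) (last xs) a b) (hd xs) a (last xs) b = E"
      using switchable[OF t(2-4)] RD(2)[OF t(2)] by (intro switch_switch) auto
    then show "(\<lambda>(E, xs, a, b). (switch E (hd xs) a (last xs) b, xs, a, b)) (\<phi> t) = t"
      by (simp add: \<phi>_def t)
  qed
  moreover have "\<phi> ` X \<subseteq> Y"
  proof
    fix s assume "s \<in> \<phi> ` X"
    then obtain E xs a b where t: "s = \<phi> (E, xs, a, b)" "E \<in> R" "xs \<in> cycles k E" "(a, b) \<in> A E xs"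
      by (auto simp: X_def)
    note sw = switchable[OF t(2-4)]
    define E' where "E' = switch E (hd xs) (last xs) a b"
    have "E' \<in> R" unfolding E'_def R_def
      using sw t(2) unfolding R_def by (intro switch_regular) auto
    moreover have "is_path E' xs"
      unfolding is_path_def successively_conv_nth
    proof (intro conjI allI impI)
      show dist: "distinct xs" using cyc(1)[OF t(3)] by (simp add: is_path_def)
      fix i assume i: "Suc i < length xs"
      have "(xs ! i, xs ! Suc i) \<in> E"
        using cyc(1)[OF t(3)] i by (auto simp: is_path_def successively_conv_nth)
      moreover have "xs ! i \<in> set xs" "xs ! Suc i \<in> set xs" using i by auto
      \<comment> \<open>Because k \<ge> 3, the closing edge does not join two consecutive entries of
        the list, so removing it leaves the path intact.\<close>
      moreover have "(xs ! i, xs ! Suc i) \<noteq> (hd xs, last xs)" "(xs ! i, xs ! Suc i) \<noteq> (last xs, hd xs)"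
      proof -
        have len: "length xs = k" "xs \<noteq> []" using cyc(2)[OF t(3)] k by auto
        then have "hd xs = xs ! 0" "last xs = xs ! (k - 1)" by (auto simp: hd_conv_nth last_conv_nth)
        then show "(xs ! i, xs ! Suc i) \<noteq> (hd xs, last xs)" "(xs ! i, xs ! Suc i) \<noteq> (last xs, hd xs)"
          using dist i len k by (auto simp: nth_eq_iff_index_eq)
      qed
      ultimately show "(xs ! i, xs ! Suc i) \<in> E'" using sw by (auto simp: E'_def switch_def)
    qed
    ultimately have "(E', xs, a, b) \<in> Y"
      using cyc(2)[OF t(3)] by (auto simp: Y_def Q_def E'_def switch_def)
    then show "s \<in> Y" using t by (simp add: \<phi>_def E'_def)
  qed
  moreover have finY: "finite Y" using finR finQ by (auto simp: Y_def)
  ultimately have "card X \<le> card Y" by (rule card_inj_on_le)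
  also have "card Y = (\<Sum>E\<in>R. card (Q E))" unfolding Y_def using finR finQ by (simp add: card_SigmaI)
  also have "\<dots> \<le> (\<Sum>E\<in>R. n * d ^ (k + 1))" by (intro sum_mono cardQ)
  finally have X_le: "card X \<le> card R * (n * d ^ (k + 1))" by simp
  have finA: "finite (A E xs)" if "E \<in> R" for E xs
    by (rule finite_subset[OF _ RD(6)[OF that]]) (auto simp: A_def)
  have "(n * d - 2 * ((k + d) * d)) * (\<Sum>E\<in>R. card (cycles k E))
    = (\<Sum>E\<in>R. \<Sum>xs\<in>cycles k E. n * d - 2 * ((k + d) * d))"
    by (simp add: sum_distrib_right mult.commute)
  also have "\<dots> \<le> (\<Sum>E\<in>R. \<Sum>xs\<in>cycles k E. card (A E xs))" by (intro sum_mono cardA)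
  also have "\<dots> = (\<Sum>E\<in>R. card (SIGMA xs:cycles k E. A E xs))"
    using finC finA by (intro sum.cong) (auto simp: card_SigmaI)
  also have "\<dots> = card X" unfolding X_def using finR finC finA by (subst card_SigmaI) auto
  finally show ?thesis using X_le by (simp add: R_def)
qed

text \<open>A cycle can be rotated to start at any of its vertices, so it suffices to count the
  heads of the lists, without a factor for the length.\<close>

lemma card_short_cycle_verts_le:
  assumes E: "E \<in> regular_rels n d"
  shows "card (short_cycle_verts E K) \<le> (\<Sum>k = 3..K. card (cycles k E))"
proof -
  have "E \<subseteq> {..<n} \<times> {..<n}" using E by (auto simp: regular_rels_def simple_graph_def)
  have fin: "finite (cycles k E)" for k
  proof (rule finite_subset[of _ "{xs. set xs \<subseteq> {..<n} \<and> length xs = k}"])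
    show "cycles k E \<subseteq> {xs. set xs \<subseteq> {..<n} \<and> length xs = k}"
    proof
      fix xs assume xs: "xs \<in> cycles k E"
      then have "set xs \<subseteq> short_cycle_verts E k" by (auto simp: cycles_def short_cycle_verts_def)
      then show "xs \<in> {xs. set xs \<subseteq> {..<n} \<and> length xs = k}"
        using xs short_cycle_verts_subset[OF \<open>E \<subseteq> _\<close>] by (auto simp: cycles_def)
    qed
  qed (simp add: finite_lists_length_eq)
  have "short_cycle_verts E K \<subseteq> (\<Union>k\<in>{3..K}. hd ` cycles k E)"
  proof
    fix v assume "v \<in> short_cycle_verts E K"
    then obtain xs where xs: "is_cycle E xs" "length xs \<le> K" "v \<in> set xs"
      by (auto simp: short_cycle_verts_def)
    then obtain as bs where "xs = as @ v # bs" by (meson split_list)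
    then have "is_cycle E (v # bs @ as)" "length (v # bs @ as) = length xs"
      using xs(1) by (cases "as = []"; auto simp: is_cycle_def is_path_def successively_append_iff
        successively_Cons split: if_splits)+
    then have "v # bs @ as \<in> cycles (length xs) E" by (simp add: cycles_def)
    then have "v \<in> hd ` cycles (length xs) E" by (intro image_eqI[of _ _ "v # bs @ as"]) auto
    moreover have "3 \<le> length xs" using xs(1) by (simp add: is_cycle_def)
    ultimately show "v \<in> (\<Union>k\<in>{3..K}. hd ` cycles k E)" using xs(2) by auto
  qed
  then have "card (short_cycle_verts E K) \<le> card (\<Union>k\<in>{3..K}. hd ` cycles k E)"
    using fin by (intro card_mono) auto
  also have "\<dots> \<le> (\<Sum>k = 3..K. card (hd ` cycles k E))" by (intro card_UN_le) auto
  also have "\<dots> \<le> (\<Sum>k = 3..K. card (cycles k E))" by (intro sum_mono card_image_le fin)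
  finally show ?thesis .
qed

text \<open>The assumption on n leaves at least half of the n d arcs admissible, so the mean number
  of listed k-cycles is at most 2 d^k, uniformly in n.\<close>

lemma sum_short_cycle_verts_le:
  assumes n: "4 * (K + d) \<le> n" and d: "0 < d"
  shows "(\<Sum>E\<in>regular_rels n d. card (short_cycle_verts E K))
    \<le> card (regular_rels n d) * (\<Sum>k = 3..K. 2 * d ^ k)"
proof -
  have k: "(\<Sum>E\<in>regular_rels n d. card (cycles k E)) \<le> card (regular_rels n d) * (2 * d ^ k)"
    if k: "k \<in> {3..K}" for k
  proof -
    define S where "S = (\<Sum>E\<in>regular_rels n d. card (cycles k E))"
    have "4 * ((k + d) * d) \<le> n * d"
      using mult_le_mono1[of "4 * (k + d)" n d] n k by (simp add: algebra_simps)
    then have "n * d \<le> 2 * (n * d - 2 * ((k + d) * d))" by linarith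
    then have "n * d * S \<le> 2 * (n * d - 2 * ((k + d) * d)) * S" by (rule mult_le_mono1)
    also have "\<dots> \<le> 2 * (card (regular_rels n d) * (n * d ^ (k + 1)))"
      using sum_card_cycles_le[of k n d] k by (simp add: S_def mult.assoc)
    also have "\<dots> = n * d * (card (regular_rels n d) * (2 * d ^ k))" by simp
    finally have "S \<le> card (regular_rels n d) * (2 * d ^ k)" using n d by simp
    then show ?thesis by (simp add: S_def)
  qed
  have "(\<Sum>E\<in>regular_rels n d. card (short_cycle_verts E K))
    \<le> (\<Sum>E\<in>regular_rels n d. \<Sum>k = 3..K. card (cycles k E))"
    by (intro sum_mono card_short_cycle_verts_le)
  also have "\<dots> = (\<Sum>k = 3..K. \<Sum>E\<in>regular_rels n d. card (cycles k E))" by (rule sum.swap)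
  also have "\<dots> \<le> (\<Sum>k = 3..K. card (regular_rels n d) * (2 * d ^ k))" by (intro sum_mono k)
  also have "\<dots> = card (regular_rels n d) * (\<Sum>k = 3..K. 2 * d ^ k)" by (simp add: sum_distrib_left)
  finally show ?thesis .
qed

section \<open>The asymptotic bound\<close>

text \<open>Markov's inequality, carried out by counting: the mean number of vertices on short
  cycles is bounded independently of n, so it exceeds n/m with probability O(1/n) for fixed m.
  Otherwise both error terms of the deterministic bound are multiples of n/m, and 8 d + 9 + 10 d +
  11 = 18 d + 20.\<close>

lemma prob_hopping_number_le:
  assumes d: "4 \<le> d" and m: "0 < m" and n: "4 * (m + 3 + d) \<le> n" "even (d * n)"
  shows "1 - real m * (\<Sum>k = 3..m + 3. 2 * real d ^ k) / real n
    \<le> measure_pmf.prob (random_regular_graph n d) {G. real (hopping_number G) \<le>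
      ((\<Prod>i = 1..d - 1. real i * real (d - 2) / (real i * real (d - 2) + 1))
        + (18 * real d + 20) / real m) * real n}"
proof -
  define c where "c = (\<Prod>i = 1..d - 1. real i * real (d - 2) / (real i * real (d - 2) + 1))"
  define C where "C = (\<Sum>k = 3..m + 3. 2 * real d ^ k)"
  define R where "R = regular_graphs n d"
  define z where "z G = card (short_cycle_verts (parcs G) (m + 3))" for G :: "nat pair_pre_digraph"
  define A where "A = {G :: nat pair_pre_digraph. real (hopping_number G) \<le> (c + (18 * real d + 20) / real m) * real n}"
  define B where "B = {G \<in> R. real n < real m * real (z G)}"
  have n0: "0 < n" using n d by simp
  have finR: "finite R" unfolding R_def by (rule finite_regular_graphs)
  have neR: "R \<noteq> {}"
    using regular_rels_nonempty[of d n] n by (auto simp: R_def regular_graphs_eq_image)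
  have inj: "inj_on (\<lambda>E. \<lparr>pverts = {..<n}, parcs = E\<rparr>) (regular_rels n d)"
    by (auto simp: inj_on_def)
  have "(\<Sum>G\<in>R. z G) = (\<Sum>E\<in>regular_rels n d. card (short_cycle_verts E (m + 3)))"
    unfolding R_def regular_graphs_eq_image z_def by (subst sum.reindex[OF inj]) simp
  also have "\<dots> \<le> card (regular_rels n d) * (\<Sum>k = 3..m + 3. 2 * d ^ k)"
    using n d by (intro sum_short_cycle_verts_le) auto
  also have "card (regular_rels n d) = card R"
    unfolding R_def regular_graphs_eq_image using inj by (simp add: card_image)
  finally have "real (\<Sum>G\<in>R. z G) \<le> real (card R * (\<Sum>k = 3..m + 3. 2 * d ^ k))"
    by (simp only: of_nat_le_iff)
  then have sum_z: "(\<Sum>G\<in>R. real (z G)) \<le> real (card R) * C" by (simp add: C_def)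
  have "real n * real (card B) = (\<Sum>G\<in>B. real n)" by simp
  also have "\<dots> \<le> (\<Sum>G\<in>B. real m * real (z G))" by (intro sum_mono) (auto simp: B_def)
  also have "\<dots> \<le> (\<Sum>G\<in>R. real m * real (z G))"
    using finR by (intro sum_mono2) (auto simp: B_def)
  also have "\<dots> \<le> real m * (real (card R) * C)"
    using sum_z by (simp add: mult_left_mono flip: sum_distrib_left)
  finally have cardB: "real (card B) / real (card R) \<le> real m * C / real n"
    using n0 finR neR by (simp add: field_simps card_gt_0_iff)
  have "R - B \<subseteq> A"
  proof
    fix G assume G: "G \<in> R - B"
    then obtain E where E: "G = \<lparr>pverts = {..<n}, parcs = E\<rparr>" "E \<in> regular_rels n d"
      by (auto simp: R_def regular_graphs_eq_image)
    have z: "real (z G) \<le> real n / real m" using G m by (simp add: B_def field_simps not_less)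
    have "neighbours G v = E `` {v}" for v by (auto simp: neighbours_def E)
    then have deg: "card (neighbours G v) = d" if "v \<in> pverts G" for v
      using E that by (auto simp: regular_rels_def)
    have "pair_graph G" using G by (auto simp: R_def regular_graphs_def)
    then have "real (hopping_number G) \<le> c * real n + (8 * real d + 9) * real (z G)
        + (10 * real d + 11) * real n / real m"
      using hopping_number_regular_le[of G d m] deg d m by (simp add: c_def z_def E)
    also have "\<dots> \<le> c * real n + (8 * real d + 9) * (real n / real m)
        + (10 * real d + 11) * real n / real m"
      using z by (intro add_mono mult_left_mono order_refl) auto
    also have "\<dots> = (c + (18 * real d + 20) / real m) * real n"
      by (simp add: algebra_simps add_divide_distrib)
    finally show "G \<in> A" by (simp add: A_def)
  qed
  then have "R - B \<subseteq> R \<inter> A" by auto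
  then have "card (R - B) \<le> card (R \<inter> A)" using finR by (intro card_mono) auto
  moreover have "card (R - B) = card R - card B" "card B \<le> card R"
    using finR by (auto simp: B_def card_Diff_subset intro: card_mono)
  ultimately have "real (card R) - real (card B) \<le> real (card (R \<inter> A))" by linarith
  then have "(real (card R) - real (card B)) / real (card R) \<le> real (card (R \<inter> A)) / real (card R)"
    by (rule divide_right_mono) simp
  then have "1 - real (card B) / real (card R) \<le> real (card (R \<inter> A)) / real (card R)"
    using finR neR by (simp add: diff_divide_distrib)
  also have "\<dots> = measure_pmf.prob (random_regular_graph n d) A"
    using finR neR by (simp add: random_regular_graph_def R_def measure_pmf_of_set)
  finally show ?thesis using cardB by (simp add: A_def c_def C_def)
qed

text \<open>
  Diagonalisation: the infimum of the admissible error terms \<open>e\<close> at \<open>n\<close>, plus \<open>1 / (n + 1)\<close> so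
  that it is exceeded by an admissible one, works for all tolerances at once.
\<close>
lemma vanishing_error:
  fixes p :: "nat \<Rightarrow> real \<Rightarrow> real" and S :: "nat set"
  assumes mono: "\<And>n x y. n \<in> S \<Longrightarrow> x \<le> y \<Longrightarrow> p n x \<le> p n y"
    and p01: "\<And>n x. 0 \<le> p n x" "\<And>n x. p n x \<le> 1"
    and lim: "\<And>e. 0 < e \<Longrightarrow> \<forall>\<^sub>F n in sequentially. n \<in> S \<longrightarrow> 1 - e \<le> p n e"
  shows "\<exists>\<delta>. \<delta> \<longlonglongrightarrow> 0 \<and> ((\<lambda>n. p n (\<delta> n)) \<longlongrightarrow> 1) (inf sequentially (principal S))"
proof -
  \<comment> \<open>For n outside S every e \<ge> 0 is admissible, so the infimum tends to 0 along
    all n and not only along S. The value 1 is always admissible, since probabilities are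
    nonnegative.\<close>
  define X where "X n = {e. 0 \<le> e \<and> (n \<in> S \<longrightarrow> 1 - e \<le> p n e)}" for n
  define \<delta> where "\<delta> n = Inf (X n) + 1 / real (Suc n)" for n
  have bdd: "bdd_below (X n)" for n by (rule bdd_belowI[of _ 0]) (auto simp: X_def)
  have one: "1 \<in> X n" for n using p01(1) by (auto simp: X_def)
  have "X n \<noteq> {}" for n using one by blast
  then have Inf_nonneg: "0 \<le> Inf (X n)" for n by (rule cInf_greatest) (simp add: X_def)
  have lim_Inf: "(\<lambda>n. Inf (X n)) \<longlonglongrightarrow> 0"
  proof (rule tendstoI)
    fix e :: real assume "0 < e"
    then have "0 < e / 2" by simp
    from lim[OF this] show "\<forall>\<^sub>F n in sequentially. dist (Inf (X n)) 0 < e"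
    proof eventually_elim
      case (elim n)
      then have "e / 2 \<in> X n" using \<open>0 < e\<close> by (simp add: X_def)
      then have "Inf (X n) \<le> e / 2" using bdd by (rule cInf_lower)
      then show ?case using Inf_nonneg[of n] \<open>0 < e\<close> by (simp add: dist_real_def)
    qed
  qed
  have "(\<lambda>n. 1 / real (Suc n)) \<longlonglongrightarrow> 0"
    using LIMSEQ_inverse_real_of_nat by (simp add: inverse_eq_divide)
  from tendsto_add[OF lim_Inf this] have \<delta>: "\<delta> \<longlonglongrightarrow> 0" unfolding \<delta>_def by simp
  have lower: "1 - \<delta> n \<le> p n (\<delta> n)" if n: "n \<in> S" for n
  proof -
    have "Inf (X n) < \<delta> n" by (simp add: \<delta>_def)
    then obtain e where e: "e \<in> X n" "e < \<delta> n" using cInf_lessD[of "X n" "\<delta> n"] one by blast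
    then have "1 - e \<le> p n e" using n by (simp add: X_def)
    also have "\<dots> \<le> p n (\<delta> n)" using e n by (intro mono) auto
    finally show ?thesis using e by simp
  qed
  have "((\<lambda>n. p n (\<delta> n)) \<longlongrightarrow> 1) (inf sequentially (principal S))"
  proof (rule tendsto_sandwich)
    show "\<forall>\<^sub>F n in inf sequentially (principal S). 1 - \<delta> n \<le> p n (\<delta> n)"
      unfolding eventually_inf_principal using lower by (intro always_eventually) auto
    show "\<forall>\<^sub>F n in inf sequentially (principal S). p n (\<delta> n) \<le> 1"
      by (intro always_eventually allI p01)
    have "((\<lambda>n. 1 - \<delta> n) \<longlonglongrightarrow> 1)" using tendsto_diff[OF tendsto_const \<delta>, of 1] by simp
    then show "((\<lambda>n. 1 - \<delta> n) \<longlongrightarrow> 1) (inf sequentially (principal S))"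
      by (rule tendsto_mono[rotated]) simp
  qed auto
  with \<delta> show ?thesis by blast
qed

theorem theorem1p3:
  fixes d :: nat
  assumes "d \<ge> 4"
  shows "\<exists>\<delta> :: nat \<Rightarrow> real. \<delta> \<longlonglongrightarrow> 0 \<and>
    aas_regular d (\<lambda>n G. real (hopping_number G) \<le>
      (1 + \<delta> n) *
        (fact (d - 1) * real (d - 2) ^ (d - 1) / (\<Prod>i = 1..d - 1. (real i * real (d - 2) + 1))) *
        real n)"
proof -
  define c where "c = fact (d - 1) * real (d - 2) ^ (d - 1) / (\<Prod>i = 1..d - 1. (real i * real (d - 2) + 1))"
  have c_eq: "c = (\<Prod>i = 1..d - 1. real i * real (d - 2) / (real i * real (d - 2) + 1))"
    by (simp add: c_def prod_dividef prod.distrib fact_prod)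
  \<comment> \<open>Positivity of c is what converts the additive error (18 d + 20) / m into a
    relative one.\<close>
  have c_pos: "0 < c" unfolding c_eq using assms by (intro prod_pos) (auto intro!: divide_pos_pos add_nonneg_pos)
  define p where "p n x = measure_pmf.prob (random_regular_graph n d)
    {G. real (hopping_number G) \<le> (1 + x) * c * real n}" for n x
  have "\<exists>\<delta>. \<delta> \<longlonglongrightarrow> 0 \<and> ((\<lambda>n. p n (\<delta> n)) \<longlongrightarrow> 1) (inf sequentially (principal {n. even (d * n)}))"
  proof (rule vanishing_error)
    show "p n x \<le> p n y" if "x \<le> y" for n x y
      unfolding p_def
    proof (rule measure_pmf.finite_measure_mono)
      have "(1 + x) * c * real n \<le> (1 + y) * c * real n"
        using that c_pos by (intro mult_right_mono) auto
      then show "{G. real (hopping_number G) \<le> (1 + x) * c * real n}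
        \<subseteq> {G. real (hopping_number G) \<le> (1 + y) * c * real n}" by auto
    qed simp
    show "0 \<le> p n x" "p n x \<le> 1" for n x by (auto simp: p_def)
    fix e :: real assume e: "0 < e"
    obtain m :: nat where "(18 * real d + 20) / (e * c) < real m" using reals_Archimedean2 by blast
    moreover have "0 < (18 * real d + 20) / (e * c)" using e c_pos by (auto intro!: divide_pos_pos add_nonneg_pos)
    ultimately have m: "0 < m" by (intro gr0I) auto
    with \<open>_ < real m\<close> have m_le: "(18 * real d + 20) / real m \<le> e * c"
      using e c_pos by (simp add: divide_less_eq divide_le_eq mult_ac)
    define C where "C = real m * (\<Sum>k = 3..m + 3. 2 * real d ^ k)"
    have "(\<lambda>n. C / real n) \<longlonglongrightarrow> 0" by (rule lim_const_over_n)
    then have "\<forall>\<^sub>F n in sequentially. C / real n < e" using e by (rule order_tendstoD)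
    moreover have "\<forall>\<^sub>F n in sequentially. 4 * (m + 3 + d) \<le> n" by (rule eventually_ge_at_top)
    ultimately show "\<forall>\<^sub>F n in sequentially. n \<in> {n. even (d * n)} \<longrightarrow> 1 - e \<le> p n e"
    proof eventually_elim
      case (elim n)
      show ?case
      proof
        assume "n \<in> {n. even (d * n)}"
        then have "1 - C / real n \<le> measure_pmf.prob (random_regular_graph n d)
          {G. real (hopping_number G) \<le> (c + (18 * real d + 20) / real m) * real n}"
          using prob_hopping_number_le[OF assms m elim(2)] by (simp add: C_def c_eq)
        also have "\<dots> \<le> p n e"
          unfolding p_def
        proof (rule measure_pmf.finite_measure_mono)
          have "(c + (18 * real d + 20) / real m) * real n \<le> (1 + e) * c * real n"
            using m_le by (intro mult_right_mono) (auto simp: algebra_simps)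
          then show "{G. real (hopping_number G) \<le> (c + (18 * real d + 20) / real m) * real n}
            \<subseteq> {G. real (hopping_number G) \<le> (1 + e) * c * real n}" by auto
        qed simp
        finally show "1 - e \<le> p n e" using elim(1) by simp
      qed
    qed
  qed
  then show ?thesis unfolding aas_regular_def p_def c_def .
qed

end
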